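(* Let $\Sigma^*\to G$, $w\mapsto \overline{w}$, be a choice of generators for a group $G$, and let $\#$ be a letter not in $\Sigma$. Then $G$ is word hyperbolic if and only if there exists a regular combing $R\subset\Sigma^*$ such that the language $$M=\{u\#v\#w \mid u,v,w\in R,\ \overline{u}\,\overline{v}\,\overline{w}=1\}\subset(\Sigma\cup\{\#\})^*$$ is context-free.
   Context: A choice of generators for a group $G$ consists of a finite alphabet $\Sigma$ equipped with formal inverses (a permutation $a\mapsto a^{-1}$ of $\Sigma$ all of whose orbits have length two, extended to $\Sigma^*$ by $(wv)^{-1}=v^{-1}w^{-1}$) together with a surjective monoid homomorphism $\Sigma^*\to G$, $w\mapsto\overline{w}$, satisfying $\overline{w^{-1}}=\overline{w}^{-1}$. A combing is a language $R\subset\Sigma^*$ whose image under $w\mapsto\overline w$ is all of $G$; it is a regular combing if $R$ is a regular language. Word hyperbolicity is with respect to the word metric on $G$ determined by the generators. *)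

theory Defs
  imports Complex_Main "HOL-Algebra.Group"
begin

definition word_ev :: "('g, 'b) monoid_scheme \<Rightarrow> ('a \<Rightarrow> 'g) \<Rightarrow> 'a list \<Rightarrow> 'g" where
  "word_ev G ev w = foldr (\<lambda>a x. ev a \<otimes>\<^bsub>G\<^esub> x) w \<one>\<^bsub>G\<^esub>"

definition gen_choice :: "('g, 'b) monoid_scheme \<Rightarrow> 'a set \<Rightarrow> ('a \<Rightarrow> 'a) \<Rightarrow> ('a \<Rightarrow> 'g) \<Rightarrow> bool" where
  "gen_choice G S iv ev \<longleftrightarrow>
     group G \<and> finite S \<and>
     (\<forall>a\<in>S. iv a \<in> S \<and> iv a \<noteq> a \<and> iv (iv a) = a) \<and>
     (\<forall>a\<in>S. ev a \<in> carrier G) \<and>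
     (\<forall>a\<in>S. ev (iv a) = inv\<^bsub>G\<^esub> (ev a)) \<and>
     (\<forall>g\<in>carrier G. \<exists>w\<in>lists S. word_ev G ev w = g)"

definition word_dist :: "('g, 'b) monoid_scheme \<Rightarrow> 'a set \<Rightarrow> ('a \<Rightarrow> 'g) \<Rightarrow> 'g \<Rightarrow> 'g \<Rightarrow> nat" where
  "word_dist G S ev g h =
     (LEAST n. \<exists>w\<in>lists S. length w = n \<and> word_ev G ev w = inv\<^bsub>G\<^esub> g \<otimes>\<^bsub>G\<^esub> h)"

definition gromov_prod :: "('g, 'b) monoid_scheme \<Rightarrow> 'a set \<Rightarrow> ('a \<Rightarrow> 'g) \<Rightarrow> 'g \<Rightarrow> 'g \<Rightarrow> 'g \<Rightarrow> real" where
  "gromov_prod G S ev x y p =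
     (real (word_dist G S ev p x) + real (word_dist G S ev p y) - real (word_dist G S ev x y)) / 2"

definition word_hyperbolic :: "('g, 'b) monoid_scheme \<Rightarrow> 'a set \<Rightarrow> ('a \<Rightarrow> 'g) \<Rightarrow> bool" where
  "word_hyperbolic G S ev \<longleftrightarrow>
     (\<exists>\<delta>::real. \<forall>x\<in>carrier G. \<forall>y\<in>carrier G. \<forall>z\<in>carrier G. \<forall>p\<in>carrier G.
        gromov_prod G S ev x z p \<ge> min (gromov_prod G S ev x y p) (gromov_prod G S ev y z p) - \<delta>)"

definition regular_lang :: "'a set \<Rightarrow> 'a list set \<Rightarrow> bool" where
  "regular_lang A L \<longleftrightarrow>
     (\<exists>(Q::nat set) q0 \<delta> F. finite Q \<and> q0 \<in> Q \<and> F \<subseteq> Q \<and>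
        (\<forall>q\<in>Q. \<forall>a\<in>A. \<delta> q a \<in> Q) \<and>
        L = {w \<in> lists A. foldl \<delta> q0 w \<in> F})"

definition cfg_step :: "(nat \<times> (nat + 'a) list) set \<Rightarrow> (nat + 'a) list \<Rightarrow> (nat + 'a) list \<Rightarrow> bool" where
  "cfg_step P u v \<longleftrightarrow>
     (\<exists>l r X \<alpha>. (X, \<alpha>) \<in> P \<and> u = l @ [Inl X] @ r \<and> v = l @ \<alpha> @ r)"

definition context_free :: "'a set \<Rightarrow> 'a list set \<Rightarrow> bool" where
  "context_free A L \<longleftrightarrow>
     (\<exists>P (S0::nat). finite P \<and>
        (\<forall>(X, \<alpha>)\<in>P. \<forall>a. Inr a \<in> set \<alpha> \<longrightarrow> a \<in> A) \<and>
        L = {w \<in> lists A. (cfg_step P)\<^sup>*\<^sup>* [Inl S0] (map Inr w)})"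

end

theory Submission
  imports Defs
begin

text \<open>
  If \<open>G\<close> is hyperbolic, take for \<open>R\<close> the geodesic words. They form a regular language because the
  cone of an element is determined by its lengths on a ball of fixed radius around it. The sides of
  a geodesic triangle fellow-travel in pairs, so the word \<open>u#v#w\<close> bounds a disc triangulated by chords
  of bounded length; the words bounding such discs are generated by a grammar whose nonterminals
  carry the group element of a chord, and intersecting with the regular language \<open>R#R#R\<close> gives the
  language of triangles.

  Conversely, every nonterminal that occurs in a derivation of a triangle has a well-defined value
  in \<open>G\<close> (reading \<open>#\<close> as the identity), because replacing its yield by another one gives again a
  triangle. In a triangle with sides of minimal length in \<open>R\<close>, a node whose yield contains no \<open>#\<close> has
  bounded yield, as that could otherwise be shortened. Hence these triangles are thin, and Bowditch's
  criterion for guessing geodesics applies to the paths labelled by shortest words of \<open>R\<close>.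
\<close>

section \<open>Bowditch's criterion\<close>

text \<open>In the converse, the obstacle is that nothing bounds a shortest word of \<open>R\<close>
  by the length of its value, so triangles with such sides cannot be compared with geodesic ones
  directly. Bowditch's criterion asks only for thinness, connected paths and a bound on the paths
  between vertices at distance at most 1; the grammar, the prefixes of a word and the finiteness of
  \<open>S\<close> supply these. Two different bounds are at work in the grammar: minimality in
  \<open>R\<close> bounds the yield of a marker-free node, whereas a node with markers may have a
  long yield and only its value, the displacement between its two ends, is bounded. In the forward
  direction, the obstacle is finiteness: chord labels range over a ball whose radius must not depend
  on the triangle. The tripod over a geodesic triangle provides it: rungs across a corner have
  length at most \<open>2 * K\<close>, and the middle needs \<open>4 * K + 3\<close>. The
  hyperbolicity estimates use doubled Gromov products and so stay in the integers.\<close>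

locale graph_metric =
  fixes V :: "'v set" and d :: "'v \<Rightarrow> 'v \<Rightarrow> nat"
  assumes d_refl: "x \<in> V \<Longrightarrow> d x x = 0"
    and d_sym: "x \<in> V \<Longrightarrow> y \<in> V \<Longrightarrow> d x y = d y x"
    and d_triangle: "x \<in> V \<Longrightarrow> y \<in> V \<Longrightarrow> z \<in> V \<Longrightarrow> d x z \<le> d x y + d y z"
    and geodesic_exists: "x \<in> V \<Longrightarrow> y \<in> V \<Longrightarrow> \<exists>c. c 0 = x \<and> c (d x y) = y \<and>
      (\<forall>i\<le>d x y. c i \<in> V) \<and> (\<forall>i j. i \<le> j \<and> j \<le> d x y \<longrightarrow> d (c i) (c j) = j - i)"
begin

definition geodesic :: "nat \<Rightarrow> (nat \<Rightarrow> 'v) \<Rightarrow> bool" where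
  "geodesic n c \<longleftrightarrow> (\<forall>i\<le>n. c i \<in> V) \<and> (\<forall>i j. i \<le> j \<and> j \<le> n \<longrightarrow> d (c i) (c j) = j - i)"

lemma geodesic_in: "geodesic n c \<Longrightarrow> i \<le> n \<Longrightarrow> c i \<in> V"
  by (simp add: geodesic_def)

lemma geodesic_dist: "geodesic n c \<Longrightarrow> i \<le> j \<Longrightarrow> j \<le> n \<Longrightarrow> d (c i) (c j) = j - i"
  by (simp add: geodesic_def)

lemma geodesic_dist': "geodesic n c \<Longrightarrow> i \<le> j \<Longrightarrow> j \<le> n \<Longrightarrow> d (c j) (c i) = j - i"
  using d_sym geodesic_dist geodesic_in by (metis le_trans)

lemma geodesic_segment:
  assumes "geodesic n c" "i + m \<le> n"
  shows "geodesic m (\<lambda>k. c (i + k))"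
  using assms by (auto simp: geodesic_def)

lemma geodesic_reverse:
  assumes "geodesic n c"
  shows "geodesic n (\<lambda>k. c (n - k))"
  using assms geodesic_dist'[OF assms] by (auto simp: geodesic_def)

end

text \<open>Bowditch's criterion: a family of paths whose triangles are thin must follow the geodesics,
  so that its thin triangles yield hyperbolicity.\<close>

locale thin_path_family = graph_metric V d
  for V :: "'v set" and d :: "'v \<Rightarrow> 'v \<Rightarrow> nat" +
  fixes L :: "'v \<Rightarrow> 'v \<Rightarrow> 'v set" and D :: nat
  assumes D_pos: "D > 0"
    and L_path: "x \<in> V \<Longrightarrow> y \<in> V \<Longrightarrow> \<exists>c n. c 0 = x \<and> c n = y \<and>
      (\<forall>i<n. d (c i) (c (Suc i)) \<le> 1) \<and> L x y = c ` {..n} \<and> L x y \<subseteq> V"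
    and L_thin: "x \<in> V \<Longrightarrow> y \<in> V \<Longrightarrow> z \<in> V \<Longrightarrow> p \<in> L x y \<Longrightarrow> \<exists>q \<in> L y z \<union> L z x. d p q \<le> D"
    and L_short: "x \<in> V \<Longrightarrow> y \<in> V \<Longrightarrow> d x y \<le> 1 \<Longrightarrow> p \<in> L x y \<Longrightarrow> d p x \<le> D"
begin

lemma L_in: "x \<in> V \<Longrightarrow> y \<in> V \<Longrightarrow> p \<in> L x y \<Longrightarrow> p \<in> V"
  using L_path by blast

text \<open>Bisection: each halving of the index interval uses one thin triangle over its midpoint
  and costs \<open>D\<close>. The indices are unordered, because the two new sides supplied by
  \<open>L_thin\<close> run backwards and \<open>L x y\<close> need not equal
  \<open>L y x\<close>.\<close>

lemma L_log_close:
  assumes "geodesic n c"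
  shows "i \<le> n \<Longrightarrow> j \<le> n \<Longrightarrow> i - j \<le> 2 ^ k \<Longrightarrow> j - i \<le> 2 ^ k \<Longrightarrow> p \<in> L (c i) (c j) \<Longrightarrow>
    \<exists>t. min i j \<le> t \<and> t \<le> max i j \<and> d p (c t) \<le> D * (k + 1)"
proof (induction k arbitrary: i j p)
  case 0
  then have "d (c i) (c j) \<le> 1"
    using geodesic_dist[OF assms, of i j] geodesic_dist'[OF assms, of j i] by (cases "i \<le> j") auto
  then have "d p (c i) \<le> D"
    using 0 L_short geodesic_in[OF assms] by blast
  then show ?case by (intro exI[of _ i]) auto
next
  case (Suc k)
  define m where "m = (i + j) div 2"
  have m: "m \<le> n" "i - m \<le> 2 ^ k" "m - i \<le> 2 ^ k" "j - m \<le> 2 ^ k" "m - j \<le> 2 ^ k"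
    "min i j \<le> m" "m \<le> max i j"
    using Suc.prems(1-4) unfolding m_def by auto
  have V: "c i \<in> V" "c j \<in> V" "c m \<in> V"
    using geodesic_in[OF assms] Suc.prems m by auto
  obtain q where q: "q \<in> L (c j) (c m) \<union> L (c m) (c i)" "d p q \<le> D"
    using L_thin[OF V Suc.prems(5)] by blast
  have "p \<in> V" "q \<in> V"
    using L_in V q Suc.prems by blast+
  obtain t where t: "min i j \<le> t" "t \<le> max i j" "d q (c t) \<le> D * (k + 1)"
  proof (cases "q \<in> L (c j) (c m)")
    case True
    from Suc.IH[OF \<open>j \<le> n\<close> m(1,4,5) this] obtain t
      where "min j m \<le> t" "t \<le> max j m" "d q (c t) \<le> D * (k + 1)" by blast
    with that[of t] m(6,7) show ?thesis by linarith
  next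
    case False
    then have "q \<in> L (c m) (c i)" using q by auto
    from Suc.IH[OF m(1) \<open>i \<le> n\<close> m(3,2) this] obtain t
      where "min m i \<le> t" "t \<le> max m i" "d q (c t) \<le> D * (k + 1)" by blast
    with that[of t] m(6,7) show ?thesis by linarith
  qed
  have "c t \<in> V" using t(2) Suc.prems geodesic_in[OF assms] by auto
  then have "d p (c t) \<le> d p q + d q (c t)"
    using d_triangle \<open>p \<in> V\<close> \<open>q \<in> V\<close> by blast
  also have "\<dots> \<le> D * (Suc k + 1)" using q t by simp
  finally show ?case using t by blast
qed

text \<open>Exponential growth beats linear growth: over a window of length \<open>6 * F\<close> the
  logarithmic estimate, increased by the cost \<open>2 * D\<close> of two thin triangles, is smaller
  than \<open>F\<close> once \<open>F\<close> is large.\<close>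

lemma log_bound: "\<exists>F0 \<ge> 2 * D. \<forall>F > F0. \<exists>k. 6 * F \<le> 2 ^ k \<and> 2 * D + D * (k + 1) < F"
proof -
  have "\<exists>k0. \<forall>k\<ge>k0. 6 * D * (k + 4) \<le> (2::nat) ^ k"
  proof -
    obtain k1 where k1: "6 * D \<le> (2::nat) ^ k1"
      by (meson less_exp order_less_imp_le)
    have double: "2 * n \<le> (2::nat) ^ n" if "n \<ge> 2" for n
      using that by (induction n rule: nat_induct_at_least) auto
    have bound: "k + 4 \<le> 2 ^ (k - k1)" if "k \<ge> 3 * k1 + 10" for k
      using double[of "k - k1"] that by linarith
    have "6 * D * (k + 4) \<le> 2 ^ k" if "k \<ge> 3 * k1 + 10" for k
    proof -
      have "6 * D * (k + 4) \<le> 2 ^ k1 * 2 ^ (k - k1)"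
        using bound[OF that] by (intro mult_mono k1) auto
      also have "\<dots> = 2 ^ k" using that by (simp flip: power_add)
      finally show ?thesis .
    qed
    then show ?thesis by blast
  qed
  then obtain k0 where k0: "\<And>k. k \<ge> k0 \<Longrightarrow> 6 * D * (k + 4) \<le> 2 ^ k" by blast
  have "\<exists>k. 6 * F \<le> 2 ^ k \<and> 2 * D + D * (k + 1) < F" if "F > D * (k0 + 4)" for F
  proof -
    \<comment> \<open>The largest \<open>k\<close> with \<open>D * (k + 3) < F\<close>. It grows
      linearly in \<open>F\<close>, so \<open>2 ^ k\<close> overtakes \<open>6 * F\<close>.\<close>
    define k where "k = (F - 1) div D - 3"
    have "D * (k0 + 4) \<le> F - 1" using that by simp
    then have "k0 + 4 \<le> (F - 1) div D"
      using D_pos by (metis div_le_mono nonzero_mult_div_cancel_left less_not_refl2)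
    then have k: "k + 3 = (F - 1) div D" "k \<ge> k0" by (auto simp: k_def)
    have "D * (k + 3) \<le> F - 1" unfolding k by (simp add: mult.commute)
    then have 1: "2 * D + D * (k + 1) < F" using that by (simp add: algebra_simps)
    have "F - 1 < D * ((F - 1) div D + 1)"
      using D_pos by (metis add.commute dividend_less_times_div mult_Suc_right plus_1_eq_Suc add.right_neutral)
    then have "F \<le> D * (k + 4)" unfolding k(1)[symmetric] by (simp add: algebra_simps)
    then have "6 * F \<le> 2 ^ k" using k0[OF k(2)] by simp
    with 1 show ?thesis by blast
  qed
  then show ?thesis by (intro exI[of _ "D * (k0 + 4)"]) auto
qed

text \<open>The logarithmic bound improves itself. At a point realising the least uniform bound, cut
  out a window of the geodesic whose length is proportional to that bound; the point is near the
  path over this window, where the logarithm of the bound would do instead.\<close>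

lemma L_near_geodesic:
  "\<exists>F. \<forall>n c. geodesic n c \<longrightarrow> (\<forall>p \<in> L (c 0) (c n). \<exists>t\<le>n. d p (c t) \<le> F)"
proof -
  obtain F0 where F0: "2 * D \<le> F0" "\<And>F. F > F0 \<Longrightarrow> \<exists>k. 6 * F \<le> 2 ^ k \<and> 2 * D + D * (k + 1) < F"
    using log_bound by blast
  \<comment> \<open>Only geodesics of length up to \<open>N\<close> are considered, so that the
    logarithmic estimate gives some bound and a least one exists. What matters is that the least
    bound never exceeds \<open>F0\<close>, which is independent of \<open>N\<close>.\<close>
  define near where "near N F \<longleftrightarrow>
    (\<forall>n c. n \<le> N \<longrightarrow> geodesic n c \<longrightarrow> (\<forall>p \<in> L (c 0) (c n). \<exists>t\<le>n. d p (c t) \<le> F))" for N F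
  have near_F0: "\<exists>F\<le>F0. near N F" for N
  proof -
    have "near N (D * (N + 1))"
      unfolding near_def
    proof (intro allI impI ballI)
      fix n c p assume c: "n \<le> N" "geodesic n c" "p \<in> L (c 0) (c n)"
      have "n \<le> 2 ^ N" using c(1) by (meson less_exp less_imp_le order_trans)
      then show "\<exists>t\<le>n. d p (c t) \<le> D * (N + 1)"
        using L_log_close[OF c(2), of 0 n N p] c(3) by auto
    qed
    define F where "F = (LEAST F. near N F)"
    have nF: "near N F" unfolding F_def by (rule LeastI) fact
    have "F \<le> F0"
    proof (rule ccontr)
      assume "\<not> F \<le> F0"
      then have F: "F > F0" by simp
      then have "F > 0" by simp
      then have "\<not> near N (F - 1)"
        unfolding F_def by (metis not_less_Least diff_less zero_less_one F_def)
      then obtain n c p where c: "n \<le> N" "geodesic n c" and p: "p \<in> L (c 0) (c n)"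
        and far: "\<And>t. t \<le> n \<Longrightarrow> \<not> d p (c t) \<le> F - 1"
        unfolding near_def by blast
      have far: "F \<le> d p (c t)" if "t \<le> n" for t using far[OF that] by simp
      obtain t where t: "t \<le> n" "d p (c t) \<le> F"
        using nF c p unfolding near_def by blast
      obtain k where k: "6 * F \<le> 2 ^ k" "2 * D + D * (k + 1) < F" using F0 F by blast
      have DF: "2 * D < F" using F F0 by simp
      have F3: "3 * D < F" using k(2) by simp
      \<comment> \<open>A point within \<open>2 * D\<close> of \<open>p\<close> on a path outside
        the window would be within \<open>F\<close> of a vertex of the geodesic outside it, and this
        vertex would be within \<open>2 * F + 2 * D < 3 * F\<close> of \<open>c t\<close>. If the
        window reaches an end of the geodesic, the outer path there joins a vertex to itself and
        \<open>L_short\<close> applies.\<close>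
      define a where "a = t - 3 * F"
      define b where "b = min n (t + 3 * F)"
      have ab: "a \<le> n" "b \<le> n" "a \<le> t" "t \<le> b" using t by (auto simp: a_def b_def)
      have V: "c 0 \<in> V" "c n \<in> V" "c a \<in> V" "c b \<in> V" "c t \<in> V"
        using geodesic_in[OF c(2)] ab t(1) by auto
      have V: "c 0 \<in> V" "c n \<in> V" "c a \<in> V" "c b \<in> V" "c t \<in> V" "p \<in> V"
        by (fact V L_in[OF V(1,2) p])+
      have far_left: False if q: "q \<in> L (c a) (c 0)" "d p q \<le> 2 * D" for q
      proof (cases "a = 0")
        case True
        have "q \<in> V" using L_in q V by blast
        have "d q (c 0) \<le> D" using L_short[of "c 0" "c 0" q] q True d_refl V by simp
        then have "d p (c 0) \<le> 3 * D" using d_triangle[of p q "c 0"] V q \<open>q \<in> V\<close> by simp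
        then show False using far[of 0] F3 by linarith
      next
        case False
        have "q \<in> V" using L_in q V by blast
        have "geodesic a c" using c(2) ab by (auto simp: geodesic_def)
        from geodesic_reverse[OF this] nF have "\<forall>p\<in>L (c a) (c 0). \<exists>s\<le>a. d p (c (a - s)) \<le> F"
          unfolding near_def using ab c(1) by fastforce
        then obtain s where s: "d q (c (a - s)) \<le> F" using q by blast
        have sV: "c (a - s) \<in> V" using geodesic_in[OF c(2)] ab by simp
        have "3 * F \<le> t - (a - s)" using False ab by (auto simp: a_def)
        also have "\<dots> = d (c t) (c (a - s))" using geodesic_dist'[OF c(2)] t ab by simp
        also have "\<dots> \<le> d (c t) p + (d p q + d q (c (a - s)))"
          using d_triangle V sV \<open>q \<in> V\<close> by (meson add_left_mono le_trans)
        also have "\<dots> \<le> F + (2 * D + F)" using t q s d_sym V by (intro add_mono) auto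
        finally show False using DF by simp
      qed
      have far_right: False if q: "q \<in> L (c b) (c n)" "d p q \<le> 2 * D" for q
      proof (cases "b = n")
        case True
        have "q \<in> V" using L_in q V by blast
        have "d q (c n) \<le> D" using L_short[of "c n" "c n" q] q True d_refl V by simp
        then have "d p (c n) \<le> 3 * D" using d_triangle[of p q "c n"] V q \<open>q \<in> V\<close> by simp
        then show False using far[of n] F3 by linarith
      next
        case False
        have "q \<in> V" using L_in q V by blast
        have "geodesic (n - b) (\<lambda>k. c (b + k))" using geodesic_segment[OF c(2)] ab by simp
        with nF have "\<forall>p\<in>L (c b) (c n). \<exists>s\<le>n - b. d p (c (b + s)) \<le> F"
          unfolding near_def using ab c(1) by fastforce
        then obtain s where s: "s \<le> n - b" "d q (c (b + s)) \<le> F" using q by blast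
        have sV: "c (b + s) \<in> V" using geodesic_in[OF c(2)] ab s by simp
        have "3 * F \<le> b + s - t" using False ab by (auto simp: b_def)
        also have "\<dots> = d (c t) (c (b + s))" using geodesic_dist[OF c(2)] t ab s by simp
        also have "\<dots> \<le> d (c t) p + (d p q + d q (c (b + s)))"
          using d_triangle V sV \<open>q \<in> V\<close> by (meson add_left_mono le_trans)
        also have "\<dots> \<le> F + (2 * D + F)" using t q s d_sym V by (intro add_mono) auto
        finally show False using DF by simp
      qed
      \<comment> \<open>Two thin triangles, with vertices \<open>c 0\<close>, \<open>c n\<close>,
        \<open>c a\<close> and \<open>c n\<close>, \<open>c a\<close>, \<open>c b\<close>, move
        \<open>p\<close> by at most \<open>2 * D\<close> in all onto the path over the
        window.\<close>
      obtain p1 where p1: "p1 \<in> L (c n) (c a) \<union> L (c a) (c 0)" "d p p1 \<le> D"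
        using L_thin[OF V(1,2,3) p] by blast
      with far_left have p1a: "p1 \<in> L (c n) (c a)" by force
      then have "p1 \<in> V" using L_in V by blast
      obtain p2 where p2: "p2 \<in> L (c a) (c b) \<union> L (c b) (c n)" "d p1 p2 \<le> D"
        using L_thin[OF V(2,3,4) p1a] by blast
      then have "p2 \<in> V" using L_in V by blast
      then have dp2: "d p p2 \<le> 2 * D"
        using d_triangle[of p p1 p2] V \<open>p1 \<in> V\<close> p1(2) p2(2) by simp
      with far_right p2 have p2a: "p2 \<in> L (c a) (c b)" by blast
      have "b - a \<le> 6 * F" unfolding a_def b_def by auto
      then obtain s where s: "s \<le> max a b" "d p2 (c s) \<le> D * (k + 1)"
        using L_log_close[OF c(2), of a b k p2] k(1) p2a ab by auto
      then have "s \<le> n" using ab by auto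
      then have "F \<le> d p p2 + d p2 (c s)"
        using far d_triangle[of p p2 "c s"] V \<open>p2 \<in> V\<close> geodesic_in[OF c(2)] by (meson le_trans)
      then show False using dp2 s k(2) by simp
    qed
    with nF show ?thesis by blast
  qed
  have "\<exists>t\<le>n. d p (c t) \<le> F0" if "geodesic n c" "p \<in> L (c 0) (c n)" for n c p
  proof -
    obtain F where "F \<le> F0" "near n F" using near_F0 by blast
    with that show ?thesis unfolding near_def by (meson le_trans order_refl)
  qed
  then show ?thesis by blast
qed

text \<open>A point within \<open>F\<close> of a geodesic fails to be between its ends by at most
  \<open>2 * F\<close>.\<close>

lemma L_detour:
  "\<exists>F. \<forall>x\<in>V. \<forall>y\<in>V. \<forall>m\<in>L x y. d x m + d m y \<le> d x y + 2 * F"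
proof -
  obtain F where F: "\<And>n c p. geodesic n c \<Longrightarrow> p \<in> L (c 0) (c n) \<Longrightarrow> \<exists>t\<le>n. d p (c t) \<le> F"
    using L_near_geodesic by blast
  have "d x m + d m y \<le> d x y + 2 * F" if xy: "x \<in> V" "y \<in> V" "m \<in> L x y" for x y m
  proof -
    obtain c where c: "c 0 = x" "c (d x y) = y" "geodesic (d x y) c"
      using geodesic_exists[OF xy(1,2)] unfolding geodesic_def by blast
    have "m \<in> L (c 0) (c (d x y))" using c xy by simp
    then obtain t where t: "t \<le> d x y" "d m (c t) \<le> F" using F[OF c(3)] by blast
    have V: "c t \<in> V" "m \<in> V" using geodesic_in[OF c(3) t(1)] L_in[OF xy] .
    have "d x (c t) = t" "d (c t) y = d x y - t"
      using geodesic_dist[OF c(3) le0 t(1)] geodesic_dist[OF c(3) t(1) order_refl]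
      unfolding c(1,2) by simp_all
    moreover have "d x m \<le> d x (c t) + d (c t) m" "d m y \<le> d m (c t) + d (c t) y"
      using d_triangle[of x "c t" m] d_triangle[of m "c t" y] V xy by auto
    ultimately show ?thesis using t d_sym[OF V] by simp
  qed
  then show ?thesis by blast
qed

text \<open>Up to a constant, the Gromov product of \<open>x\<close> and \<open>y\<close> at
  \<open>p\<close> is the distance from \<open>p\<close> to \<open>L x y\<close>:
  \<open>upper\<close> bounds it by the distance to any point of the path, \<open>lower\<close>
  finds a point that nearly attains it. Thinness moves such a point of \<open>L x z\<close> to one
  of the other two sides.\<close>

theorem four_point:
  "\<exists>K::nat. \<forall>x\<in>V. \<forall>y\<in>V. \<forall>z\<in>V. \<forall>p\<in>V.
     min (int (d p x) + int (d p y) - int (d x y)) (int (d p y) + int (d p z) - int (d y z))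
       \<le> int (d p x) + int (d p z) - int (d x z) + K"
proof -
  obtain F where F: "\<And>x y m. x \<in> V \<Longrightarrow> y \<in> V \<Longrightarrow> m \<in> L x y \<Longrightarrow> d x m + d m y \<le> d x y + 2 * F"
    using L_detour by blast
  \<comment> \<open>The sum of \<open>4 * F + 4 * D + 4\<close> from \<open>lower\<close>,
    \<open>2 * F\<close> from \<open>upper\<close> and \<open>2 * D\<close> for moving to another
    side.\<close>
  define K where "K = 6 * F + 6 * D + 4"
  have upper: "int (d p x) + int (d p y) - int (d x y) \<le> 2 * int (d p m) + 2 * F"
    if "x \<in> V" "y \<in> V" "p \<in> V" "m \<in> L x y" for x y p m
  proof -
    have "m \<in> V" using L_in that by blast
    then have "d p x \<le> d p m + d x m" "d p y \<le> d p m + d m y"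
      using d_triangle[of p m x] d_triangle[of p m y] d_sym[of x m] that by auto
    then show ?thesis using F[OF that(1,2,4)] by simp
  qed
  have lower: "\<exists>m\<in>L x z. 2 * int (d p m) \<le> int (d p x) + int (d p z) - int (d x z) + 4 * F + 4 * D + 4"
    if xzp: "x \<in> V" "z \<in> V" "p \<in> V" for x z p
  proof -
    obtain c n where c: "c 0 = x" "c n = z" "\<And>i. i < n \<Longrightarrow> d (c i) (c (Suc i)) \<le> 1"
      "L x z = c ` {..n}"
      using L_path[OF xzp(1,2)] by auto
    have cV: "c i \<in> V" if "i \<le> n" for i using L_in[OF xzp(1,2), of "c i"] c(4) that by auto
    \<comment> \<open>Discrete connectedness: at the first vertex of the path that is not near
      \<open>L p x\<close>, thinness gives nearness to \<open>L z p\<close>, and its predecessor is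
      near both. Stepping back one edge accounts for \<open>D + 1\<close>.\<close>
    define A where "A i \<longleftrightarrow> (\<exists>q \<in> L p x. d (c i) q \<le> D + 1)" for i
    have "x \<in> L p x" using L_path[OF xzp(3,1)] by force
    then have A0: "A 0" unfolding A_def c(1) using d_refl[OF xzp(1)] by (metis le0)
    have "z \<in> L z p" using L_path[OF xzp(2,3)] by force
    have "\<exists>i\<le>n. A i \<and> (\<exists>q \<in> L z p. d (c i) q \<le> D + 1)"
    proof (cases "\<forall>i\<le>n. A i")
      case True
      then show ?thesis using \<open>z \<in> L z p\<close> d_refl[OF xzp(2)] c(2) by (intro exI[of _ n]) force
    next
      case False
      define j where "j = (LEAST j. j \<le> n \<and> \<not> A j)"
      have j: "j \<le> n" "\<not> A j" "\<And>i. i < j \<Longrightarrow> A i"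
      proof -
        show "j \<le> n" "\<not> A j" using LeastI_ex[of "\<lambda>j. j \<le> n \<and> \<not> A j"] False unfolding j_def by auto
        then show "A i" if "i < j" for i
          using that not_less_Least[of i "\<lambda>j. j \<le> n \<and> \<not> A j"] unfolding j_def by auto
      qed
      obtain i where i: "j = Suc i" using A0 j(2) by (cases j) auto
      have "c j \<in> L x z" using c(4) j by auto
      then obtain q where q: "q \<in> L z p \<union> L p x" "d (c j) q \<le> D" using L_thin xzp by blast
      with j(2) have "q \<in> L z p" unfolding A_def by force
      then have "q \<in> V" using L_in xzp by blast
      have "d (c i) q \<le> d (c i) (c j) + d (c j) q"
        using d_triangle[of "c i" "c j" q] cV \<open>q \<in> V\<close> i j by simp
      then have "d (c i) q \<le> D + 1" using c(3)[of i] i j q by simp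
      then show ?thesis using \<open>q \<in> L z p\<close> i j by (intro exI[of _ i]) auto
    qed
    then obtain i q1 q2 where i: "i \<le> n" and q: "q1 \<in> L p x" "d (c i) q1 \<le> D + 1"
      "q2 \<in> L z p" "d (c i) q2 \<le> D + 1" unfolding A_def by blast
    define m where "m = c i"
    have V: "m \<in> V" "q1 \<in> V" "q2 \<in> V" using cV i L_in q xzp unfolding m_def by blast+
    have "d x z \<le> d x m + d m z" using d_triangle V xzp by blast
    moreover have "d p m \<le> d p q1 + d m q1" "d x m \<le> d q1 x + d m q1"
      using d_triangle[of p q1 m] d_triangle[of x q1 m] d_sym V xzp by auto
    moreover have "d p m \<le> d q2 p + d m q2" "d m z \<le> d z q2 + d m q2"
      using d_triangle[of p q2 m] d_triangle[of m q2 z] d_sym V xzp by auto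
    moreover have "d p q1 + d q1 x \<le> d p x + 2 * F" "d z q2 + d q2 p \<le> d p z + 2 * F"
      using F[OF xzp(3,1) q(1)] F[OF xzp(2,3) q(3)] d_sym xzp by auto
    ultimately have "2 * int (d p m) \<le> int (d p x) + int (d p z) - int (d x z) + 4 * F + 4 * D + 4"
      using q unfolding m_def by simp
    then show ?thesis using c i unfolding m_def by blast
  qed
  have "min (int (d p x) + int (d p y) - int (d x y)) (int (d p y) + int (d p z) - int (d y z))
       \<le> int (d p x) + int (d p z) - int (d x z) + K"
    if xyzp: "x \<in> V" "y \<in> V" "z \<in> V" "p \<in> V" for x y z p
  proof -
    obtain m where m: "m \<in> L x z"
      "2 * int (d p m) \<le> int (d p x) + int (d p z) - int (d x z) + 4 * F + 4 * D + 4"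
      using lower[OF xyzp(1,3,4)] by blast
    obtain q where q: "q \<in> L z y \<union> L y x" "d m q \<le> D" using L_thin[OF xyzp(1,3,2) m(1)] by blast
    have V: "m \<in> V" "q \<in> V" using L_in xyzp m q by blast+
    have pq: "d p q \<le> d p m + D" using d_triangle[of p m q] V xyzp q by simp
    have sy: "d z y = d y z" "d y x = d x y" using d_sym xyzp by auto
    show ?thesis
    proof (cases "q \<in> L z y")
      case True
      then show ?thesis using upper[OF xyzp(3,2,4) True] pq m(2) sy unfolding K_def by simp
    next
      case False
      then have "q \<in> L y x" using q by auto
      then show ?thesis using upper[OF xyzp(2,1,4)] pq m(2) sy unfolding K_def by force
    qed
  qed
  then show ?thesis by blast
qed

end

section \<open>The word metric\<close>

context group
begin

lemma word_ev_Nil [simp]: "word_ev G f [] = \<one>"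
  and word_ev_Cons [simp]: "word_ev G f (a # w) = f a \<otimes> word_ev G f w"
  by (simp_all add: word_ev_def)

lemma word_ev_closed: "(\<And>a. a \<in> set w \<Longrightarrow> f a \<in> carrier G) \<Longrightarrow> word_ev G f w \<in> carrier G"
  by (induction w) auto

lemma word_ev_append:
  assumes "\<And>a. a \<in> set u \<Longrightarrow> f a \<in> carrier G" "\<And>a. a \<in> set v \<Longrightarrow> f a \<in> carrier G"
  shows "word_ev G f (u @ v) = word_ev G f u \<otimes> word_ev G f v"
  using assms by (induction u) (auto simp: m_assoc word_ev_closed)

lemma inv_mult_cancel:
  "a \<in> carrier G \<Longrightarrow> b \<in> carrier G \<Longrightarrow> inv a \<otimes> (a \<otimes> b) = b"
  "a \<in> carrier G \<Longrightarrow> b \<in> carrier G \<Longrightarrow> a \<otimes> (inv a \<otimes> b) = b"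
  by (simp_all flip: m_assoc)

end

lemma word_ev_cong: "(\<And>a. a \<in> set w \<Longrightarrow> f a = g a) \<Longrightarrow> word_ev G f w = word_ev G g w"
  unfolding word_ev_def by (rule foldr_cong) auto

locale generated_group = group G for G (structure) +
  fixes S :: "'s set" and iv :: "'s \<Rightarrow> 's" and ev :: "'s \<Rightarrow> 'a"
  assumes gens: "gen_choice G S iv ev"
begin

abbreviation val :: "'s list \<Rightarrow> 'a" where "val \<equiv> word_ev G ev"

lemma finite_gens: "finite S"
  and iv_in: "a \<in> S \<Longrightarrow> iv a \<in> S"
  and ev_in: "a \<in> S \<Longrightarrow> ev a \<in> carrier G"
  and ev_iv: "a \<in> S \<Longrightarrow> ev (iv a) = inv (ev a)"
  and val_surj: "g \<in> carrier G \<Longrightarrow> \<exists>w \<in> lists S. val w = g"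
  using gens unfolding gen_choice_def by blast+

lemma val_in [simp, intro]: "w \<in> lists S \<Longrightarrow> val w \<in> carrier G"
  by (rule word_ev_closed) (auto intro: ev_in)

lemma val_append [simp]: "u \<in> lists S \<Longrightarrow> v \<in> lists S \<Longrightarrow> val (u @ v) = val u \<otimes> val v"
  by (rule word_ev_append) (auto intro: ev_in)

lemma take_in [simp]: "w \<in> lists S \<Longrightarrow> take i w \<in> lists S"
  and drop_in [simp]: "w \<in> lists S \<Longrightarrow> drop i w \<in> lists S"
  by (auto dest: in_set_takeD in_set_dropD)

lemma val_inverse_word:
  "w \<in> lists S \<Longrightarrow> map iv (rev w) \<in> lists S \<and> val (map iv (rev w)) = inv (val w)"
proof (induction w)
  case (Cons a w)
  then have "[iv a] \<in> lists S" "map iv (rev w) \<in> lists S" "val w \<in> carrier G" "ev a \<in> carrier G"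
    using iv_in ev_in by auto
  then show ?case using Cons ev_iv by (auto simp: inv_mult_group)
qed simp

definition len :: "'a \<Rightarrow> nat" where
  "len g = (LEAST n. \<exists>w\<in>lists S. length w = n \<and> val w = g)"

abbreviation dist :: "'a \<Rightarrow> 'a \<Rightarrow> nat" where "dist \<equiv> word_dist G S ev"

lemma dist_eq: "dist x y = len (inv x \<otimes> y)"
  by (simp add: word_dist_def len_def)

lemma len_le: "w \<in> lists S \<Longrightarrow> len (val w) \<le> length w"
  unfolding len_def by (rule Least_le) auto

lemma shortest_word: "g \<in> carrier G \<Longrightarrow> \<exists>w\<in>lists S. length w = len g \<and> val w = g"
  unfolding len_def using val_surj by (rule_tac LeastI_ex) blast

lemma len_one [simp]: "len \<one> = 0"
  using len_le[of "[]"] by simp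

lemma len_mult: "g \<in> carrier G \<Longrightarrow> h \<in> carrier G \<Longrightarrow> len (g \<otimes> h) \<le> len g + len h"
proof -
  assume gh: "g \<in> carrier G" "h \<in> carrier G"
  obtain u v where "u \<in> lists S" "length u = len g" "val u = g" "v \<in> lists S" "length v = len h" "val v = h"
    using shortest_word gh by metis
  then show ?thesis using len_le[of "u @ v"] by simp
qed

lemma len_inv [simp]: "g \<in> carrier G \<Longrightarrow> len (inv g) = len g"
proof -
  have le: "len (inv g) \<le> len g" if "g \<in> carrier G" for g
  proof -
    obtain u where "u \<in> lists S" "length u = len g" "val u = g" using shortest_word \<open>g \<in> carrier G\<close> by metis
    then show ?thesis using val_inverse_word[of u] len_le[of "map iv (rev u)"] by simp
  qed
  assume "g \<in> carrier G"
  then show ?thesis using le[of g] le[of "inv g"] by simp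
qed

lemma finite_ball: "finite {g \<in> carrier G. len g \<le> n}"
proof (rule finite_subset)
  show "{g \<in> carrier G. len g \<le> n} \<subseteq> val ` {w. set w \<subseteq> S \<and> length w \<le> n}"
  proof
    fix g assume "g \<in> {g \<in> carrier G. len g \<le> n}"
    then show "g \<in> val ` {w. set w \<subseteq> S \<and> length w \<le> n}"
      using shortest_word[of g] by (auto simp: in_lists_conv_set)
  qed
qed (simp add: finite_lists_length_le finite_gens)

lemma dist_translate:
  assumes "g \<in> carrier G" "x \<in> carrier G" "y \<in> carrier G"
  shows "dist (g \<otimes> x) (g \<otimes> y) = dist x y"
  using assms by (simp add: dist_eq inv_mult_group m_assoc inv_mult_cancel)

lemma dist_triangle:
  assumes "x \<in> carrier G" "y \<in> carrier G" "z \<in> carrier G"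
  shows "dist x z \<le> dist x y + dist y z"
  using len_mult[of "inv x \<otimes> y" "inv y \<otimes> z"] assms by (simp add: dist_eq m_assoc inv_mult_cancel)

lemma dist_sym: "x \<in> carrier G \<Longrightarrow> y \<in> carrier G \<Longrightarrow> dist x y = dist y x"
  unfolding dist_eq using len_inv[of "inv x \<otimes> y"] by (simp add: inv_mult_group)

lemma dist_one [simp]: "g \<in> carrier G \<Longrightarrow> dist \<one> g = len g" "g \<in> carrier G \<Longrightarrow> dist g \<one> = len g"
  by (simp_all add: dist_eq)

lemma dist_word:
  assumes "w \<in> lists S" "i \<le> j"
  shows "dist (val (take i w)) (val (take j w)) \<le> j - i"
proof -
  have "take j w = take i w @ drop i (take j w)"
    using assms(2) by (metis append_take_drop_id min.absorb1 take_take)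
  moreover have "drop i (take j w) \<in> lists S" using assms by simp
  ultimately have "val (take j w) = val (take i w) \<otimes> val (drop i (take j w))"
    using assms(1) val_append by (metis take_in)
  then have "dist (val (take i w)) (val (take j w)) = len (val (drop i (take j w)))"
    using assms by (simp add: dist_eq inv_mult_cancel)
  also have "\<dots> \<le> j - i" using len_le[of "drop i (take j w)"] assms by simp
  finally show ?thesis .
qed

section \<open>Geodesic words and the word metric as a graph metric\<close>

definition geodesic_word :: "'s list \<Rightarrow> bool" where
  "geodesic_word w \<longleftrightarrow> w \<in> lists S \<and> length w = len (val w)"

text \<open>A shortcut between two prefixes would shorten the whole word.\<close>

lemma geodesic_word_dist:
  assumes "geodesic_word w" "i \<le> j" "j \<le> length w"
  shows "dist (val (take i w)) (val (take j w)) = j - i"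
proof -
  have w: "w \<in> lists S" "length w = len (val w)" using assms by (auto simp: geodesic_word_def)
  have "length w = dist (val (take 0 w)) (val (take (length w) w))" using w by simp
  also have "\<dots> \<le> dist (val (take 0 w)) (val (take i w)) +
      (dist (val (take i w)) (val (take j w)) + dist (val (take j w)) (val (take (length w) w)))"
    using dist_triangle w by (meson add_left_mono le_trans val_in take_in)
  also have "\<dots> \<le> i + (dist (val (take i w)) (val (take j w)) + (length w - j))"
    using dist_word[of w 0 i] dist_word[of w j "length w"] w assms by simp
  finally show ?thesis using dist_word[OF w(1) assms(2)] assms by linarith
qed

lemma geodesic_word_take: "geodesic_word w \<Longrightarrow> i \<le> length w \<Longrightarrow> len (val (take i w)) = i"
  using geodesic_word_dist[of w 0 i] by (simp add: geodesic_word_def)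

lemma graph_metric: "graph_metric (carrier G) dist"
proof
  fix x y assume xy: "x \<in> carrier G" "y \<in> carrier G"
  obtain w where w: "w \<in> lists S" "length w = dist x y" "val w = inv x \<otimes> y"
    using shortest_word[of "inv x \<otimes> y"] xy by (auto simp: dist_eq)
  then have geo: "geodesic_word w" by (simp add: geodesic_word_def dist_eq)
  define c where "c i = x \<otimes> val (take i w)" for i
  have "c 0 = x" "c (dist x y) = y" "\<And>i. c i \<in> carrier G"
    using xy w by (simp_all add: c_def inv_mult_cancel flip: w(2))
  moreover have "dist (c i) (c j) = j - i" if "i \<le> j" "j \<le> dist x y" for i j
    using geodesic_word_dist[OF geo that(1)] that(2) w xy by (simp add: c_def dist_translate)
  ultimately show "\<exists>c. c 0 = x \<and> c (dist x y) = y \<and> (\<forall>i\<le>dist x y. c i \<in> carrier G) \<and>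
      (\<forall>i j. i \<le> j \<and> j \<le> dist x y \<longrightarrow> dist (c i) (c j) = j - i)"
    by blast
qed (simp_all add: dist_sym dist_triangle, simp add: dist_eq)

text \<open>Doubling the Gromov products clears the denominators, and the real constant can be
  rounded up to a natural number.\<close>

lemma word_hyperbolic_iff:
  "word_hyperbolic G S ev \<longleftrightarrow> (\<exists>K::nat. \<forall>x\<in>carrier G. \<forall>y\<in>carrier G. \<forall>z\<in>carrier G. \<forall>p\<in>carrier G.
     min (int (dist p x) + int (dist p y) - int (dist x y)) (int (dist p y) + int (dist p z) - int (dist y z))
       \<le> int (dist p x) + int (dist p z) - int (dist x z) + int K)" (is "?L \<longleftrightarrow> ?R")
proof
  define P where "P x y p = int (dist p x) + int (dist p y) - int (dist x y)" for x y p
  have P: "gromov_prod G S ev x y p = of_int (P x y p) / 2" for x y p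
    by (simp add: gromov_prod_def P_def)
  {
    assume ?L
    then obtain \<delta> :: real where *: "\<And>x y z p. x \<in> carrier G \<Longrightarrow> y \<in> carrier G \<Longrightarrow> z \<in> carrier G \<Longrightarrow> p \<in> carrier G \<Longrightarrow>
        min (of_int (P x y p) / 2) (of_int (P y z p) / 2) - \<delta> \<le> of_int (P x z p) / 2"
      unfolding word_hyperbolic_def P by blast
    obtain K :: nat where K: "2 * \<delta> \<le> K" using real_arch_simple by blast
    have "min (P x y p) (P y z p) \<le> P x z p + int K"
      if "x \<in> carrier G" "y \<in> carrier G" "z \<in> carrier G" "p \<in> carrier G" for x y z p
      using *[OF that] K by (auto simp: min_def split: if_splits)
    then show ?R unfolding P_def by blast
  next
    assume ?R
    then obtain K :: nat where *: "\<And>x y z p. x \<in> carrier G \<Longrightarrow> y \<in> carrier G \<Longrightarrow> z \<in> carrier G \<Longrightarrow> p \<in> carrier G \<Longrightarrow>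
        min (P x y p) (P y z p) \<le> P x z p + int K"
      unfolding P_def by blast
    have "min (of_int (P x y p) / 2) (of_int (P y z p) / 2) - real K / 2 \<le> of_int (P x z p) / 2"
      if "x \<in> carrier G" "y \<in> carrier G" "z \<in> carrier G" "p \<in> carrier G" for x y z p
      using *[OF that] by (auto simp: min_def split: if_splits)
    then show ?L unfolding word_hyperbolic_def P by blast
  }
qed

end

section \<open>Quotients of languages and context-free grammars\<close>

definition lquot :: "'a list \<Rightarrow> 'a list set \<Rightarrow> 'a list set" where
  "lquot w L = {z. w @ z \<in> L}"

lemma lquot_Nil [simp]: "lquot [] L = L"
  and lquot_append: "lquot (u @ v) L = lquot v (lquot u L)"
  by (simp_all add: lquot_def)

lemma Nil_in_lquot [simp]: "[] \<in> lquot w L \<longleftrightarrow> w \<in> L"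
  by (simp add: lquot_def)

text \<open>The left quotients are the states of the minimal automaton, so finiteness of this set is
  the Myhill-Nerode form of regularity. It suits the geodesic language, whose quotients are
  cones.\<close>

definition quotients :: "'a set \<Rightarrow> 'a list set \<Rightarrow> 'a list set set" where
  "quotients A L = (\<lambda>w. lquot w L) ` lists A"

lemma quotientsI [intro]: "w \<in> lists A \<Longrightarrow> lquot w L \<in> quotients A L"
  by (simp add: quotients_def)

lemma quotientsE [elim]:
  assumes "X \<in> quotients A L"
  obtains w where "w \<in> lists A" "X = lquot w L"
  using assms unfolding quotients_def by blast

lemma self_in_quotients: "L \<in> quotients A L"
  using quotientsI[of "[]"] by simp

lemma quotients_lquot: "X \<in> quotients A L \<Longrightarrow> w \<in> lists A \<Longrightarrow> lquot w X \<in> quotients A L"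
  by (elim quotientsE) (metis append_in_lists_conv lquot_append quotientsI)

text \<open>The quotients themselves serve as states; \<open>e\<close> numbers them because
  \<open>regular_lang\<close> asks for states in \<open>nat\<close>. A state accepts if its quotient
  contains the empty word.\<close>

lemma regular_lang_if_finite_quotients:
  assumes "L \<subseteq> lists A" "finite (quotients A L)"
  shows "regular_lang A L"
proof -
  obtain e :: "'a list set \<Rightarrow> nat" where e: "inj_on e (quotients A L)"
    using finite_imp_inj_to_nat_seg[OF assms(2)] by blast
  define \<delta> where "\<delta> q a = e (lquot [a] (inv_into (quotients A L) e q))" for q a
  define F where "F = e ` {X \<in> quotients A L. [] \<in> X}"
  have step: "\<delta> (e X) a = e (lquot [a] X)" if "X \<in> quotients A L" for X a
    using e that by (simp add: \<delta>_def)
  have run: "foldl \<delta> (e X) w = e (lquot w X)" if "X \<in> quotients A L" "w \<in> lists A" for X w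
    using that(2,1)
  proof (induction w arbitrary: X)
    case (Cons a w)
    then have "lquot [a] X \<in> quotients A L" using quotients_lquot[of X A L "[a]"] by simp
    with Cons step show ?case using lquot_append[of "[a]" w X] by simp
  qed simp
  note L = self_in_quotients[of L A]
  have "foldl \<delta> (e L) w \<in> F \<longleftrightarrow> w \<in> L" if w: "w \<in> lists A" for w
  proof -
    have "lquot w L \<in> quotients A L" using quotients_lquot[OF L w] .
    then have "e (lquot w L) \<in> F \<longleftrightarrow> lquot w L \<in> {X \<in> quotients A L. [] \<in> X}"
      unfolding F_def by (intro inj_on_image_mem_iff[OF e]) blast+
    with \<open>lquot w L \<in> quotients A L\<close> show ?thesis unfolding run[OF L w] by simp
  qed
  then have accepts: "L = {w \<in> lists A. foldl \<delta> (e L) w \<in> F}" using assms(1) by blast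
  have closed: "\<delta> q a \<in> e ` quotients A L" if q: "q \<in> e ` quotients A L" and a: "a \<in> A" for q a
  proof -
    obtain X where X: "X \<in> quotients A L" "q = e X" using q by blast
    show ?thesis unfolding X(2) step[OF X(1)]
      by (intro imageI quotients_lquot[OF X(1)]) (simp add: a)
  qed
  show ?thesis
    unfolding regular_lang_def
  proof (intro exI conjI)
    show "finite (e ` quotients A L)" using assms(2) by simp
    show "e L \<in> e ` quotients A L" using L by (rule imageI)
    show "F \<subseteq> e ` quotients A L" unfolding F_def by blast
    show "\<forall>q\<in>e ` quotients A L. \<forall>a\<in>A. \<delta> q a \<in> e ` quotients A L" using closed by blast
    show "L = {w \<in> lists A. foldl \<delta> (e L) w \<in> F}" by (fact accepts)
  qed
qed

section \<open>Regular languages joined by a marker\<close>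

lemma finite_quotients_insert:
  assumes "L \<subseteq> lists A" "finite (quotients A L)"
  shows "finite (quotients (insert h A) L)"
proof (rule finite_subset)
  have "lquot w L = {}" if "w \<notin> lists A" for w
    using that assms(1) by (auto simp: lquot_def)
  then show "quotients (insert h A) L \<subseteq> insert {} (quotients A L)" by blast
qed (simp add: assms)

definition marked_conc :: "'a \<Rightarrow> 'a list set \<Rightarrow> 'a list set \<Rightarrow> 'a list set" where
  "marked_conc h L1 L2 = {u @ h # v | u v. u \<in> L1 \<and> v \<in> L2}"

lemma append_marker_eq:
  assumes "h \<notin> set u" "h \<notin> set u'"
  shows "u @ h # v = u' @ h # v' \<longleftrightarrow> u = u' \<and> v = v'"
  using assms by (induction u arbitrary: u') (case_tac u'; auto)+

text \<open>A prefix without the marker has only acted on the first factor; after the first marker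
  only a quotient of the second factor is left, or nothing. \<open>L2\<close> may itself contain the
  marker, so the construction can be iterated.\<close>

lemma finite_quotients_marked_conc:
  assumes L1: "L1 \<subseteq> lists A" "finite (quotients A L1)"
    and L2: "finite (quotients (insert h A) L2)" and h: "h \<notin> A"
  shows "finite (quotients (insert h A) (marked_conc h L1 L2))"
proof (rule finite_subset)
  show "quotients (insert h A) (marked_conc h L1 L2) \<subseteq>
    (\<lambda>X. marked_conc h X L2) ` quotients A L1 \<union> insert {} (quotients (insert h A) L2)"
  proof
    fix X assume "X \<in> quotients (insert h A) (marked_conc h L1 L2)"
    then obtain w where w: "w \<in> lists (insert h A)" "X = lquot w (marked_conc h L1 L2)" by (rule quotientsE)
    have L1h: "h \<notin> set u" if "u \<in> L1" for u using that L1 h by auto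
    show "X \<in> (\<lambda>X. marked_conc h X L2) ` quotients A L1 \<union> insert {} (quotients (insert h A) L2)"
    proof (cases "h \<in> set w")
      case False
      have "X = marked_conc h (lquot w L1) L2"
      proof (rule Set.set_eqI)
        fix z
        have "z \<in> X \<longleftrightarrow> (\<exists>u\<in>L1. \<exists>v\<in>L2. w @ z = u @ h # v)"
          unfolding w(2) lquot_def marked_conc_def by auto
        also have "\<dots> \<longleftrightarrow> z \<in> marked_conc h (lquot w L1) L2"
        proof
          assume "\<exists>u\<in>L1. \<exists>v\<in>L2. w @ z = u @ h # v"
          then obtain u v where uv: "u \<in> L1" "v \<in> L2" "w @ z = u @ h # v" by blast
          then obtain us where "(w = u @ us \<and> us @ z = h # v) \<or> (w @ us = u \<and> z = us @ h # v)"
            by (auto simp: append_eq_append_conv2)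
          then show "z \<in> marked_conc h (lquot w L1) L2"
          proof
            assume *: "w = u @ us \<and> us @ z = h # v"
            with False have "us = []" by (cases us) auto
            with * uv show ?thesis unfolding marked_conc_def lquot_def by fastforce
          next
            assume "w @ us = u \<and> z = us @ h # v"
            with uv show ?thesis unfolding marked_conc_def lquot_def by blast
          qed
        next
          assume "z \<in> marked_conc h (lquot w L1) L2"
          then obtain u v where "z = u @ h # v" "w @ u \<in> L1" "v \<in> L2"
            unfolding marked_conc_def lquot_def by blast
          then show "\<exists>u\<in>L1. \<exists>v\<in>L2. w @ z = u @ h # v"
            by (intro bexI[of _ "w @ u"] bexI[of _ v]) simp_all
        qed
        finally show "z \<in> X \<longleftrightarrow> z \<in> marked_conc h (lquot w L1) L2" .
      qed
      moreover have "w \<in> lists A" using w(1) False by auto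
      ultimately show ?thesis by blast
    next
      case True
      then obtain w1 w2 where w12: "w = w1 @ h # w2" "h \<notin> set w1" by (meson split_list_first)
      have "X = (if w1 \<in> L1 then lquot w2 L2 else {})"
        unfolding w(2) w12 lquot_def marked_conc_def using append_marker_eq[OF w12(2)] L1h by auto
      moreover have "w2 \<in> lists (insert h A)" using w(1) w12 by auto
      ultimately show ?thesis by auto
    qed
  qed
qed (use assms in auto)

text \<open>Parse trees with their yields. Induction over them splits a word along the children of a
  node, whereas \<open>cfg_step\<close> rewrites in arbitrary order. The type of nonterminals is
  left open so that grammars can be built with structured ones.\<close>

inductive yields :: "('n \<times> ('n + 'a) list) set \<Rightarrow> 'n + 'a \<Rightarrow> 'a list \<Rightarrow> bool" for P where
  letter: "yields P (Inr a) [a]"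
| rule: "(X, \<alpha>) \<in> P \<Longrightarrow> list_all2 (yields P) \<alpha> zs \<Longrightarrow> yields P (Inl X) (concat zs)"

section \<open>Derivations and parse trees agree\<close>

lemma cfg_step_context: "cfg_step P u v \<Longrightarrow> cfg_step P (l @ u @ r) (l @ v @ r)"
  unfolding cfg_step_def by (metis append.assoc)

lemma derives_context:
  "(cfg_step P)\<^sup>*\<^sup>* u v \<Longrightarrow> (cfg_step P)\<^sup>*\<^sup>* (l @ u @ r) (l @ v @ r)"
  by (induction rule: rtranclp_induct) (auto intro: cfg_step_context rtranclp.rtrancl_into_rtrancl)

lemma derives_append:
  assumes "(cfg_step P)\<^sup>*\<^sup>* u u'" "(cfg_step P)\<^sup>*\<^sup>* v v'"
  shows "(cfg_step P)\<^sup>*\<^sup>* (u @ v) (u' @ v')"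
  using derives_context[OF assms(1), of "[]" v] derives_context[OF assms(2), of u' "[]"] by simp

lemma derives_list:
  "list_all2 (\<lambda>s z. (cfg_step P)\<^sup>*\<^sup>* [s] (map Inr z)) \<alpha> zs \<Longrightarrow> (cfg_step P)\<^sup>*\<^sup>* \<alpha> (map Inr (concat zs))"
proof (induction rule: list_all2_induct)
  case (Cons s \<alpha> z zs)
  then show ?case using derives_append[of P "[s]" "map Inr z" \<alpha> "map Inr (concat zs)"] by simp
qed simp

lemma cfg_step_rule: "(X, \<alpha>) \<in> P \<Longrightarrow> cfg_step P [Inl X] \<alpha>"
  unfolding cfg_step_def by (metis append_Nil append_Nil2)

lemma yields_imp_derives: "yields P s z \<Longrightarrow> (cfg_step P)\<^sup>*\<^sup>* [s] (map Inr z)"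
proof (induction rule: yields.induct)
  case (rule X \<alpha> zs)
  then have "(cfg_step P)\<^sup>*\<^sup>* \<alpha> (map Inr (concat zs))"
    by (intro derives_list) (auto elim: list_all2_mono)
  with rule(1) show ?case by (blast intro: converse_rtranclp_into_rtranclp cfg_step_rule)
qed simp

lemma list_all2_letters: "list_all2 (yields P) (map Inr w) (map (\<lambda>a. [a]) w)"
  by (induction w) (auto intro: letter)

text \<open>Read backwards, each rewriting step gathers the trees over the right-hand side of a rule
  under a new node; a sentential form is the list of roots of a forest.\<close>

lemma derives_imp_yields_list:
  "(cfg_step P)\<^sup>*\<^sup>* u (map Inr w) \<Longrightarrow> \<exists>zs. list_all2 (yields P) u zs \<and> concat zs = w"
proof (induction rule: converse_rtranclp_induct)
  case base
  show ?case by (intro exI[of _ "map (\<lambda>a. [a]) w"] conjI list_all2_letters) simp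
next
  case (step u v)
  then obtain l r X \<alpha> zs where *: "(X, \<alpha>) \<in> P" "u = l @ [Inl X] @ r" "v = l @ \<alpha> @ r"
    "list_all2 (yields P) v zs" "concat zs = w"
    unfolding cfg_step_def by blast
  then obtain zl za zr where zs: "zs = zl @ za @ zr" "list_all2 (yields P) l zl"
    "list_all2 (yields P) \<alpha> za" "list_all2 (yields P) r zr"
    by (auto simp: list_all2_append1)
  have "yields P (Inl X) (concat za)" using *(1) zs(3) by (rule yields.rule)
  then show ?case using zs * by (intro exI[of _ "zl @ [concat za] @ zr"]) (auto intro!: list_all2_appendI)
qed

lemma derives_iff_yields: "(cfg_step P)\<^sup>*\<^sup>* [s] (map Inr w) \<longleftrightarrow> yields P s w"
proof
  assume "(cfg_step P)\<^sup>*\<^sup>* [s] (map Inr w)"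
  then show "yields P s w" using derives_imp_yields_list by (fastforce simp: list_all2_Cons1)
qed (rule yields_imp_derives)

text \<open>Needed because \<open>context_free\<close> fixes \<open>nat\<close> as the type of
  nonterminals. The numbering is injective only on \<open>N\<close>, so the direction back to
  \<open>R\<close> has to carry along that all nonterminals met lie in \<open>N\<close>.\<close>

lemma yields_rename:
  fixes R :: "('n \<times> ('n + 'a) list) set"
  assumes "inj_on e N" "fst ` R \<subseteq> N" "\<And>X \<alpha> Y. (X, \<alpha>) \<in> R \<Longrightarrow> Inl Y \<in> set \<alpha> \<Longrightarrow> Y \<in> N"
    and "X \<in> N"
  shows "yields ((\<lambda>(X, \<alpha>). (e X, map (map_sum e id) \<alpha>)) ` R) (Inl (e X)) z \<longleftrightarrow> yields R (Inl X) z"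
    (is "yields ?P _ _ \<longleftrightarrow> _")
proof
  have "\<forall>s. t = map_sum e id s \<longrightarrow> (\<forall>Y. s = Inl Y \<longrightarrow> Y \<in> N) \<longrightarrow> yields R s z" if "yields ?P t z" for t z
    using that
  proof (induction rule: yields.induct)
    case (letter a)
    show ?case
    proof (intro allI impI)
      fix s :: "'n + 'a" assume "Inr a = map_sum e id s"
      then have "s = Inr a" by (cases s) auto
      then show "yields R s [a]" by (simp add: yields.letter)
    qed
  next
    case (rule X' \<alpha>' zs)
    then obtain X \<alpha> where R: "(X, \<alpha>) \<in> R" "X' = e X" "\<alpha>' = map (map_sum e id) \<alpha>" by auto
    have "list_all2 (\<lambda>s z. \<forall>s'. map_sum e id s = map_sum e id s' \<longrightarrow> (\<forall>Y. s' = Inl Y \<longrightarrow> Y \<in> N) \<longrightarrow> yields R s' z) \<alpha> zs"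
      using rule(2) unfolding R(3) list_all2_map1 by (auto elim: list_all2_mono)
    then have "list_all2 (yields R) \<alpha> zs"
      unfolding list_all2_conv_all_nth using assms(3)[OF R(1)] by (metis nth_mem)
    from yields.rule[OF R(1) this] have *: "yields R (Inl X) (concat zs)" .
    have "X \<in> N" using R(1) assms(2) by force
    show ?case
    proof (intro allI impI)
      fix s :: "'n + 'a" assume s: "Inl X' = map_sum e id s" "\<forall>Y. s = Inl Y \<longrightarrow> Y \<in> N"
      then obtain Y where "s = Inl Y" "e Y = X'" "Y \<in> N" by (cases s) auto
      with * R(2) \<open>X \<in> N\<close> assms(1) show "yields R s (concat zs)" by (auto dest: inj_onD)
    qed
  qed
  then show "yields R (Inl X) z" if "yields ?P (Inl (e X)) z"
    using that assms(4) by (metis map_sum.simps(1) sum.inject(1))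
next
  have "yields ?P (map_sum e id s) z" if "yields R s z" for s z
    using that
  proof (induction rule: yields.induct)
    case (letter a)
    then show ?case by (simp add: yields.letter)
  next
    case (rule X \<alpha> zs)
    from rule(2) have "list_all2 (yields ?P) (map (map_sum e id) \<alpha>) zs"
      unfolding list_all2_map1 by (rule list_all2_mono) (elim conjE)
    moreover have "(e X, map (map_sum e id) \<alpha>) \<in> ?P" using rule(1) by force
    ultimately show ?case unfolding map_sum.simps by (intro yields.rule)
  qed
  then show "yields ?P (Inl (e X)) z" if "yields R (Inl X) z"
    using that by (metis map_sum.simps(1))
qed

lemma context_free_yields:
  assumes "finite R" "\<And>X \<alpha> a. (X, \<alpha>) \<in> R \<Longrightarrow> Inr a \<in> set \<alpha> \<Longrightarrow> a \<in> A"
  shows "context_free A {w \<in> lists A. yields R (Inl X0) w}"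
proof -
  \<comment> \<open>On terminals \<open>projl\<close> is unspecified; this is harmless, since
    \<open>N\<close> has only to be a finite set containing all nonterminals.\<close>
  define N where "N = insert X0 (fst ` R) \<union> (\<Union>(X, \<alpha>) \<in> R. projl ` set \<alpha>)"
  have "finite N" unfolding N_def using assms(1) by auto
  then obtain e :: "_ \<Rightarrow> nat" where e: "inj_on e N" using finite_imp_inj_to_nat_seg by blast
  define P where "P = (\<lambda>(X, \<alpha>). (e X, map (map_sum e id) \<alpha>)) ` R"
  have "yields P (Inl (e X0)) w \<longleftrightarrow> yields R (Inl X0) w" for w
    unfolding P_def by (rule yields_rename[OF e]) (force simp: N_def)+
  then have "{w \<in> lists A. yields R (Inl X0) w} = {w \<in> lists A. (cfg_step P)\<^sup>*\<^sup>* [Inl (e X0)] (map Inr w)}"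
    by (simp add: derives_iff_yields)
  moreover have "finite P" using assms(1) by (simp add: P_def)
  moreover have "a \<in> A" if "(X, \<alpha>) \<in> P" "Inr a \<in> set \<alpha>" for X \<alpha> a
  proof -
    obtain Y \<beta> s where R: "(Y, \<beta>) \<in> R" "s \<in> set \<beta>" "Inr a = map_sum e id s"
      using \<open>(X, \<alpha>) \<in> P\<close> \<open>Inr a \<in> set \<alpha>\<close> unfolding P_def by auto
    then have "s = Inr a" by (cases s) auto
    with R assms(2) show ?thesis by blast
  qed
  ultimately show ?thesis unfolding context_free_def by (intro exI[of _ P] exI[of _ "e X0"]) auto
qed

section \<open>Grammars for the boundary words of triangulated discs\<close>

context group
begin

text \<open>The words that bound a disc triangulated with all chords in \<open>B\<close>.\<close>

inductive tri :: "'c set \<Rightarrow> ('c \<Rightarrow> 'a) \<Rightarrow> 'a set \<Rightarrow> 'c list \<Rightarrow> 'a \<Rightarrow> bool" for A f B where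
  tri_empty: "tri A f B [] \<one>"
| tri_letter: "a \<in> A \<Longrightarrow> f a \<in> B \<Longrightarrow> tri A f B [a] (f a)"
| tri_mult: "tri A f B u g \<Longrightarrow> tri A f B v h \<Longrightarrow> g \<otimes> h \<in> B \<Longrightarrow> tri A f B (u @ v) (g \<otimes> h)"

lemma tri_in_lists: "tri A f B w g \<Longrightarrow> w \<in> lists A"
  by (induction rule: tri.induct) auto

lemma tri_in: "tri A f B w g \<Longrightarrow> \<one> \<in> B \<Longrightarrow> g \<in> B"
  by (induction rule: tri.induct) auto

lemma tri_value: "tri A f B w g \<Longrightarrow> (\<And>a. a \<in> A \<Longrightarrow> f a \<in> carrier G) \<Longrightarrow> word_ev G f w = g"
proof (induction rule: tri.induct)
  case (tri_mult u g v h)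
  have "word_ev G f (u @ v) = word_ev G f u \<otimes> word_ev G f v"
    using tri_in_lists[OF tri_mult(1)] tri_in_lists[OF tri_mult(2)] tri_mult(6)
    by (intro word_ev_append) auto
  then show ?case using tri_mult by simp
qed auto

text \<open>The triple construction for the intersection with a regular language, with quotients as
  states: \<open>Some (X, g, Y)\<close> generates the words with chord \<open>g\<close> that lead
  from the quotient \<open>X\<close> to \<open>Y\<close>, and \<open>None\<close> starts at
  \<open>L\<close> and demands a final quotient containing the empty word. Finitely many chords and
  quotients leave finitely many rules.\<close>

lemma context_free_tri:
  assumes "finite A" "finite B" "\<one> \<in> B" "finite (quotients A L)"
  shows "context_free A {w \<in> L. tri A f B w \<one>}"
proof -
  let ?Q = "quotients A L"
  define start :: "(('c list set \<times> 'a \<times> 'c list set) option \<times> (('c list set \<times> 'a \<times> 'c list set) option + 'c) list) set"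
    where "start = (\<lambda>Y. (None, [Inl (Some (L, \<one>, Y))])) ` {Y \<in> ?Q. [] \<in> Y}"
  define mult :: "(('c list set \<times> 'a \<times> 'c list set) option \<times> (('c list set \<times> 'a \<times> 'c list set) option + 'c) list) set"
    where "mult = (\<lambda>(X, g, Z, h, Y). (Some (X, g \<otimes> h, Y), [Inl (Some (X, g, Z)), Inl (Some (Z, h, Y))]))
      ` {(X, g, Z, h, Y). X \<in> ?Q \<and> g \<in> B \<and> Z \<in> ?Q \<and> h \<in> B \<and> Y \<in> ?Q \<and> g \<otimes> h \<in> B}"
  define unit :: "(('c list set \<times> 'a \<times> 'c list set) option \<times> (('c list set \<times> 'a \<times> 'c list set) option + 'c) list) set"
    where "unit = (\<lambda>X. (Some (X, \<one>, X), [])) ` ?Q"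
  define letters :: "(('c list set \<times> 'a \<times> 'c list set) option \<times> (('c list set \<times> 'a \<times> 'c list set) option + 'c) list) set"
    where "letters = (\<lambda>(X, a). (Some (X, f a, lquot [a] X), [Inr a])) ` (?Q \<times> {a \<in> A. f a \<in> B})"
  define R where "R = start \<union> mult \<union> unit \<union> letters"
  have "finite mult"
    unfolding mult_def
    by (intro finite_imageI, rule finite_subset[of _ "?Q \<times> B \<times> ?Q \<times> B \<times> ?Q"]) (use assms in auto)
  then have "finite R" using assms by (simp add: R_def start_def unit_def letters_def)
  moreover have "a \<in> A" if "(X, \<alpha>) \<in> R" "Inr a \<in> set \<alpha>" for X \<alpha> a
    using that by (auto simp: R_def start_def mult_def unit_def letters_def)
  ultimately have "context_free A {w \<in> lists A. yields R (Inl None) w}"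
    by (rule context_free_yields) blast+
  moreover have "{w \<in> lists A. yields R (Inl None) w} = {w \<in> L. tri A f B w \<one>}"
  proof (intro Set.set_eqI iffI)
    define sound where "sound s w = (case s of Inl None \<Rightarrow> w \<in> L \<and> tri A f B w \<one>
      | Inl (Some (X, g, Y)) \<Rightarrow> tri A f B w g \<and> Y = lquot w X | Inr a \<Rightarrow> w = [a])" for s w
    have "sound s w" if "yields R s w" for s w
      using that
    proof (induction rule: yields.induct)
      case (rule N \<alpha> zs)
      then have zs: "list_all2 sound \<alpha> zs" by (auto elim: list_all2_mono)
      from rule(1) consider "(N, \<alpha>) \<in> start" | "(N, \<alpha>) \<in> mult" | "(N, \<alpha>) \<in> unit" | "(N, \<alpha>) \<in> letters"
        unfolding R_def by blast
      then show ?case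
      proof cases
        case 1
        then show ?thesis using zs unfolding start_def by (auto simp: sound_def list_all2_Cons1)
      next
        case 2
        then obtain X g Z h Y where N: "N = Some (X, g \<otimes> h, Y)" "g \<otimes> h \<in> B"
          "\<alpha> = [Inl (Some (X, g, Z)), Inl (Some (Z, h, Y))]"
          unfolding mult_def by auto
        with zs obtain u v where "zs = [u, v]" "tri A f B u g" "Z = lquot u X" "tri A f B v h" "Y = lquot v Z"
          by (auto simp: sound_def list_all2_Cons1)
        with N show ?thesis by (auto simp: sound_def lquot_append intro: tri_mult)
      next
        case 3
        then show ?thesis using zs unfolding unit_def by (auto simp: sound_def intro: tri_empty)
      next
        case 4
        then show ?thesis using zs unfolding letters_def
          by (auto simp: sound_def list_all2_Cons1 intro: tri_letter)
      qed
    qed (simp add: sound_def)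
    then show "w \<in> {w \<in> L. tri A f B w \<one>}" if "w \<in> {w \<in> lists A. yields R (Inl None) w}" for w
      using that unfolding sound_def by fastforce
  next
    have complete: "yields R (Inl (Some (X, g, lquot w X))) w" if "tri A f B w g" "X \<in> ?Q" for w g X
      using that
    proof (induction arbitrary: X rule: tri.induct)
      case tri_empty
      then have "(Some (X, \<one>, X), []) \<in> R" by (simp add: R_def unit_def)
      from yields.rule[OF this, of "[]"] show ?case by simp
    next
      case (tri_letter a)
      then have "(Some (X, f a, lquot [a] X), [Inr a]) \<in> R" by (force simp: R_def letters_def)
      from yields.rule[OF this, of "[[a]]"] show ?case by (simp add: yields.letter)
    next
      case (tri_mult u g v h)
      define Z where "Z = lquot u X"
      have Z: "Z \<in> ?Q" "lquot v Z \<in> ?Q"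
        unfolding Z_def using quotients_lquot tri_mult tri_in_lists by metis+
      have "g \<in> B" "h \<in> B" using tri_in[OF tri_mult.hyps(1)] tri_in[OF tri_mult.hyps(2)] assms(3) by simp_all
      then have "(Some (X, g \<otimes> h, lquot v Z), [Inl (Some (X, g, Z)), Inl (Some (Z, h, lquot v Z))]) \<in> mult"
        using tri_mult.prems tri_mult.hyps Z unfolding mult_def
        by (intro image_eqI[of _ _ "(X, g, Z, h, lquot v Z)"]) auto
      then have "(Some (X, g \<otimes> h, lquot v Z), [Inl (Some (X, g, Z)), Inl (Some (Z, h, lquot v Z))]) \<in> R"
        by (simp add: R_def)
      from yields.rule[OF this, of "[u, v]"] show ?case
        using tri_mult.IH(1)[OF tri_mult.prems] tri_mult.IH(2)[OF Z(1)] by (simp add: Z_def lquot_append)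
    qed
    show "w \<in> {w \<in> lists A. yields R (Inl None) w}" if "w \<in> {w \<in> L. tri A f B w \<one>}" for w
    proof -
      have w: "w \<in> L" "tri A f B w \<one>" "w \<in> lists A" using that tri_in_lists by blast+
      have L: "L \<in> ?Q" by (rule self_in_quotients)
      have "(None, [Inl (Some (L, \<one>, lquot w L))]) \<in> R"
        using w unfolding R_def start_def by auto
      from yields.rule[OF this, of "[w]"] complete[OF w(2) L] w(3) show ?thesis by simp
    qed
  qed
  ultimately show ?thesis by simp
qed

end

section \<open>Geodesic triangles in hyperbolic groups\<close>

locale marked_group = generated_group G S iv ev
  for G (structure) and S :: "'s set" and iv ev +
  fixes h :: 's
  assumes h_notin: "h \<notin> S"
begin

abbreviation alphabet :: "'s set" where "alphabet \<equiv> insert h S"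

definition mev :: "'s \<Rightarrow> 'a" where "mev = ev(h := \<one>)"

abbreviation mval :: "'s list \<Rightarrow> 'a" where "mval \<equiv> word_ev G mev"

lemma mev_in: "a \<in> alphabet \<Longrightarrow> mev a \<in> carrier G"
  by (auto simp: mev_def ev_in)

lemma mev_marker [simp]: "mev h = \<one>"
  by (simp add: mev_def)

lemma mval_in [simp, intro]: "w \<in> lists alphabet \<Longrightarrow> mval w \<in> carrier G"
  by (rule word_ev_closed) (auto intro: mev_in)

lemma mval_append [simp]:
  "u \<in> lists alphabet \<Longrightarrow> v \<in> lists alphabet \<Longrightarrow> mval (u @ v) = mval u \<otimes> mval v"
  by (rule word_ev_append) (auto intro: mev_in)

lemma mval_eq_val [simp]: "w \<in> lists S \<Longrightarrow> mval w = val w"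
  using h_notin by (intro word_ev_cong) (auto simp: mev_def)

lemma lists_alphabet [simp]: "w \<in> lists S \<Longrightarrow> w \<in> lists alphabet"
  by auto

definition triangles :: "'s list set \<Rightarrow> 's list set" where
  "triangles R = {u @ [h] @ v @ [h] @ w | u v w. u \<in> R \<and> v \<in> R \<and> w \<in> R \<and>
     val u \<otimes> val v \<otimes> val w = \<one>}"

lemma mval_triangle:
  "u \<in> lists S \<Longrightarrow> v \<in> lists S \<Longrightarrow> w \<in> lists S \<Longrightarrow>
    mval (u @ [h] @ v @ [h] @ w) = val u \<otimes> val v \<otimes> val w"
  by (simp add: m_assoc)

end

locale hyperbolic_group = marked_group G S iv ev h
  for G (structure) and S :: "'s set" and iv ev h +
  fixes K :: nat
  assumes four_point: "x \<in> carrier G \<Longrightarrow> y \<in> carrier G \<Longrightarrow> z \<in> carrier G \<Longrightarrow> p \<in> carrier G \<Longrightarrow>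
     min (int (dist p x) + int (dist p y) - int (dist x y)) (int (dist p y) + int (dist p z) - int (dist y z))
       \<le> int (dist p x) + int (dist p z) - int (dist x z) + int K"
begin

text \<open>Two four-point inequalities chained along \<open>a\<close>, \<open>x\<close>,
  \<open>y\<close>, \<open>b\<close> and based at the identity, where \<open>t\<close> bounds the
  doubled Gromov products of neighbours from below; each inequality loses \<open>K\<close>.\<close>

lemma five_point:
  assumes "a \<in> carrier G" "x \<in> carrier G" "y \<in> carrier G" "b \<in> carrier G"
    and "int (len a) + int (len x) - int (dist a x) \<ge> t"
    and "int (len x) + int (len y) - int (dist x y) \<ge> t"
    and "int (len y) + int (len b) - int (dist y b) \<ge> t"
  shows "int (dist a b) \<le> int (len a) + int (len b) - t + 2 * int K"
  using four_point[of a x y \<one>] four_point[of a y b \<one>] assms by simp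

section \<open>Cannon's argument: a hyperbolic group has finitely many cones\<close>

definition cone :: "'a \<Rightarrow> 's list set" where
  "cone g = {w \<in> lists S. len (g \<otimes> val w) = len g + length w}"

text \<open>A finite trace of the length function near \<open>g\<close>. The radius is the distance
  that \<open>five_point\<close> yields when \<open>t\<close> falls short of twice the length of the
  base element by 2.\<close>

definition cone_type :: "'a \<Rightarrow> 'a set" where
  "cone_type g = {x \<in> carrier G. len x \<le> 2 * K + 2 \<and> len (g \<otimes> x) \<le> len g}"

lemma len_mult_word: "g \<in> carrier G \<Longrightarrow> w \<in> lists S \<Longrightarrow> len (g \<otimes> val w) \<le> len g + length w"
  using len_mult[of g "val w"] len_le[of w] by simp

text \<open>If \<open>w = w'a\<close> were geodesic from \<open>g\<close> but not from \<open>g'\<close>, then the geodesic to \<open>g'w\<close> would pass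
  a point \<open>g'x\<close> no farther from the identity than \<open>g'\<close> and close to \<open>g'\<close>; since \<open>x\<close> is then in the
  common type, passing through \<open>gx\<close> would be a shortcut to \<open>gw\<close>.\<close>

lemma cone_type_determines_cone:
  assumes g: "g \<in> carrier G" "g' \<in> carrier G" "cone_type g = cone_type g'"
  shows "w \<in> cone g \<Longrightarrow> w \<in> cone g'"
proof (induction w rule: rev_induct)
  case Nil
  then show ?case using g by (simp add: cone_def)
next
  case (snoc a w)
  then have "w @ [a] \<in> lists S" "len (g \<otimes> val (w @ [a])) = len g + length (w @ [a])"
    unfolding cone_def by blast+
  moreover have "length (w @ [a]) = length w + 1" by simp
  ultimately have wa: "w @ [a] \<in> lists S" and gw: "len (g \<otimes> val (w @ [a])) = len g + length w + 1"
    by (simp_all only: add.assoc)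
  then have w: "w \<in> lists S" "a \<in> S" "[a] \<in> lists S" by simp_all
  have "g \<otimes> val (w @ [a]) = (g \<otimes> val w) \<otimes> val [a]"
    using w g val_append[OF w(1,3)] val_in[OF w(3)] val_in[OF w(1)] by (simp only: m_assoc)
  then have "w \<in> cone g"
    using len_mult_word[of "g \<otimes> val w" "[a]"] len_mult_word[of g w] gw w g by (simp add: cone_def)
  then have m: "len (g' \<otimes> val w) = len g' + length w" using snoc.IH by (simp add: cone_def)
  define e where "e = g' \<otimes> val (w @ [a])"
  have e_in: "e \<in> carrier G" using g w by (simp add: e_def ev_in)
  have "e = (g' \<otimes> val w) \<otimes> val [a]"
    using w g val_append[OF w(1,3)] val_in[OF w(3)] val_in[OF w(1)] unfolding e_def by (simp only: m_assoc)
  then have "dist (g' \<otimes> val w) e = len (val [a])"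
    using g w val_in[OF w(3)] by (simp only: dist_eq inv_mult_cancel m_closed val_in)
  then have d1: "dist (g' \<otimes> val w) e \<le> 1" using len_le[OF w(3)] by simp
  show ?case
  proof (rule ccontr)
    assume "w @ [a] \<notin> cone g'"
    then have "len e \<noteq> len g' + length w + 1" using wa by (simp add: cone_def e_def)
    moreover have "len e \<le> len g' + length w + 1" using len_mult_word[OF g(2) wa] by (simp add: e_def)
    ultimately have e_short: "len e \<le> len g' + length w" by simp
    have e_long: "len g' + length w \<le> len e + 1"
      using dist_triangle[of \<one> e "g' \<otimes> val w"] d1 m g w e_in dist_sym[of "g' \<otimes> val w" e] by simp
    obtain v where v: "v \<in> lists S" "length v = len e" "val v = e" using shortest_word[OF e_in] by blast
    have geo: "geodesic_word v" using v by (simp add: geodesic_word_def)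
    \<comment> \<open>The point \<open>b\<close> of the geodesic \<open>v\<close> is taken at the
      level of \<open>g'\<close>. The minimum matters when \<open>w\<close> is empty, since
      \<open>e\<close> may then be one step nearer to the identity than \<open>g'\<close>.\<close>
    define i where "i = min (len g') (length v)"
    define b where "b = val (take i v)"
    define c where "c = val (drop i v)"
    have bc: "b \<in> carrier G" "c \<in> carrier G" "e = b \<otimes> c"
      unfolding b_def c_def v(3)[symmetric] using v(1) val_append[of "take i v" "drop i v"] by simp_all
    have i: "i \<le> length v" by (simp add: i_def)
    have len_b: "len b = i" unfolding b_def using geodesic_word_take[OF geo i] .
    have dist_be: "dist b e = len e - i"
      using geodesic_word_dist[OF geo i order_refl] v by (simp add: b_def)
    have dist_g': "dist g' (g' \<otimes> val w) \<le> length w"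
      using len_le[OF w(1)] g w by (simp add: dist_eq inv_mult_cancel)
    define x where "x = inv g' \<otimes> b"
    have x: "x \<in> carrier G" "g' \<otimes> x = b" using g bc by (simp_all add: x_def inv_mult_cancel)
    \<comment> \<open>The chain runs along \<open>g'\<close>, \<open>g' \<otimes> val w\<close>,
      \<open>e\<close>, \<open>b\<close>. The loss of 2 arises because \<open>e\<close> is at most
      one step from \<open>g' \<otimes> val w\<close> and may be shorter by one.\<close>
    have "int (dist g' b) \<le> int (len g') + int (len b) - (2 * int (len g') - 2) + 2 * int K"
    proof (rule five_point[of g' "g' \<otimes> val w" e b])
      show "2 * int (len g') - 2 \<le> int (len g') + int (len (g' \<otimes> val w)) - int (dist g' (g' \<otimes> val w))"
        using m dist_g' by simp
      show "2 * int (len g') - 2 \<le> int (len (g' \<otimes> val w)) + int (len e) - int (dist (g' \<otimes> val w) e)"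
        using m d1 e_long by simp
      have "dist e b = dist b e" using dist_sym e_in bc by simp
      then show "2 * int (len g') - 2 \<le> int (len e) + int (len b) - int (dist e b)"
        using dist_be len_b e_long v(2) unfolding i_def by simp
    qed (use g w e_in bc in auto)
    then have "len x \<le> 2 * K + 2" using len_b by (simp add: x_def dist_eq i_def)
    then have "x \<in> cone_type g'" using x len_b by (simp add: cone_type_def i_def)
    then have "x \<in> cone_type g" using g(3) by simp
    then have "len (g \<otimes> x) \<le> len g" by (simp add: cone_type_def)
    moreover have "val (w @ [a]) = x \<otimes> c"
    proof -
      have "x \<otimes> c = inv g' \<otimes> e" using g bc by (simp add: x_def m_assoc)
      also have "\<dots> = val (w @ [a])" unfolding e_def using inv_mult_cancel(1)[OF g(2) val_in[OF wa]] .
      finally show ?thesis by simp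
    qed
    then have "g \<otimes> val (w @ [a]) = (g \<otimes> x) \<otimes> c" using g x bc by (simp add: m_assoc)
    moreover have "len c \<le> length w"
      using len_le[of "drop i v"] v e_short by (simp add: c_def i_def)
    ultimately show False using gw len_mult[of "g \<otimes> x" c] g x bc by simp
  qed
qed

text \<open>The cone depends only on the type, and types are subsets of a finite ball;
  \<open>SOME\<close> picks a representative of each type.\<close>

lemma finite_cones: "finite (cone ` carrier G)"
proof (rule finite_subset)
  have eq: "cone g = cone g'" if "g \<in> carrier G" "g' \<in> carrier G" "cone_type g = cone_type g'" for g g'
    using cone_type_determines_cone that by blast
  show "cone ` carrier G \<subseteq> (\<lambda>t. cone (SOME g. g \<in> carrier G \<and> cone_type g = t)) ` cone_type ` carrier G"
  proof
    fix X assume "X \<in> cone ` carrier G"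
    then obtain g where g: "g \<in> carrier G" "X = cone g" by blast
    define g' where "g' = (SOME x. x \<in> carrier G \<and> cone_type x = cone_type g)"
    have "g' \<in> carrier G \<and> cone_type g' = cone_type g"
      unfolding g'_def by (rule someI[of _ g]) (simp add: g)
    then have "X = cone g'" using eq g by metis
    then show "X \<in> (\<lambda>t. cone (SOME g. g \<in> carrier G \<and> cone_type g = t)) ` cone_type ` carrier G"
      using g unfolding g'_def by blast
  qed
  have "cone_type ` carrier G \<subseteq> Pow {g \<in> carrier G. len g \<le> 2 * K + 2}"
    by (auto simp: cone_type_def)
  then show "finite ((\<lambda>t. cone (SOME g. g \<in> carrier G \<and> cone_type g = t)) ` cone_type ` carrier G)"
    using finite_ball by (meson finite_Pow_iff finite_imageI finite_subset)
qed

text \<open>The quotient by a geodesic word is the cone of its value; the quotient by any other word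
  is empty, because prefixes of geodesic words are geodesic.\<close>

lemma finite_quotients_geodesic: "finite (quotients S {w. geodesic_word w})"
proof (rule finite_subset)
  show "quotients S {w. geodesic_word w} \<subseteq> insert {} (cone ` carrier G)"
  proof
    fix X assume "X \<in> quotients S {w. geodesic_word w}"
    then obtain u where u: "u \<in> lists S" "X = lquot u {w. geodesic_word w}" by blast
    have split: "geodesic_word (u @ w) \<longleftrightarrow> geodesic_word u \<and> w \<in> cone (val u)" for w
    proof (cases "w \<in> lists S")
      case True
      then show ?thesis using len_le[OF u(1)] len_mult_word[of "val u" w] u(1)
        by (simp add: geodesic_word_def cone_def) arith
    qed (simp add: geodesic_word_def cone_def)
    show "X \<in> insert {} (cone ` carrier G)"
    proof (cases "geodesic_word u")
      case True
      then have "X = cone (val u)" unfolding u(2) lquot_def using split by auto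
      then show ?thesis using u(1) by auto
    next
      case False
      then show ?thesis unfolding u(2) lquot_def using split by auto
    qed
  qed
qed (simp add: finite_cones)

text \<open>The last inequality assumed says that \<open>i\<close> is at most the Gromov product at
  the corner where \<open>u\<close> ends and \<open>v\<close> starts. With that corner at the
  identity, \<open>five_point\<close> applies to the point \<open>a\<close> of \<open>u\<close>, the
  start of \<open>u\<close>, the end of \<open>v\<close> and the point of \<open>v\<close>.\<close>

lemma corner_close:
  assumes "geodesic_word u" "geodesic_word v" "i \<le> length u" "i \<le> length v"
    and "2 * i + len (val u \<otimes> val v) \<le> length u + length v"
  shows "len (val (drop (length u - i) u) \<otimes> val (take i v)) \<le> 2 * K"
proof -
  have w: "u \<in> lists S" "v \<in> lists S" "len (val u) = length u" "len (val v) = length v"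
    using assms by (auto simp: geodesic_word_def)
  define j where "j = length u - i"
  define a where "a = inv (val (drop j u))"
  have u: "val u = val (take j u) \<otimes> val (drop j u)"
    using w val_append[of "take j u" "drop j u"] by simp
  have aV: "a \<in> carrier G" using w by (simp add: a_def)
  have dist_a: "dist a (inv (val u)) = length u - i"
  proof -
    have "inv a \<otimes> inv (val u) = inv (val (take j u))"
      unfolding u using w by (simp add: a_def inv_mult_group inv_mult_cancel)
    then show ?thesis using geodesic_word_take[OF assms(1), of j] w by (simp add: dist_eq j_def)
  qed
  have len_a: "len a = i"
    using geodesic_word_dist[OF assms(1), of j "length u"] w assms(3) u
    by (simp add: a_def j_def dist_eq inv_mult_cancel)
  have "int (dist a (val (take i v))) \<le> int (len a) + int (len (val (take i v))) - 2 * int i + 2 * int K"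
  proof (rule five_point[of a "inv (val u)" "val v"])
    show "2 * int i \<le> int (len a) + int (len (inv (val u))) - int (dist a (inv (val u)))"
      using w len_a dist_a assms(3) by simp
    show "2 * int i \<le> int (len (inv (val u))) + int (len (val v)) - int (dist (inv (val u)) (val v))"
      using w assms(5) by (simp add: dist_eq)
    show "2 * int i \<le> int (len (val v)) + int (len (val (take i v))) - int (dist (val v) (val (take i v)))"
      using geodesic_word_dist[OF assms(2,4) order_refl] geodesic_word_take[OF assms(2,4)] w assms(4)
        dist_sym[of "val v" "val (take i v)"] by simp
  qed (use w aV in simp_all)
  moreover have "dist a (val (take i v)) = len (val (drop j u) \<otimes> val (take i v))"
    using w by (simp add: dist_eq a_def)
  ultimately show ?thesis using len_a geodesic_word_take[OF assms(2,4)] by (simp add: j_def)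
qed

text \<open>The radius allows for the longest chord, the one closing the middle of a triangle: two
  corner chords of length at most \<open>2 * K\<close> and three leftover letters.\<close>

abbreviation bigball :: "'a set" where "bigball \<equiv> {g \<in> carrier G. len g \<le> 4 * K + 3}"

abbreviation Tri :: "'s list \<Rightarrow> bool" where "Tri w \<equiv> tri alphabet mev bigball w (mval w)"

lemma Tri_append:
  assumes "Tri u" "Tri v" "len (mval (u @ v)) \<le> 4 * K + 3"
  shows "Tri (u @ v)"
proof -
  have "u \<in> lists alphabet" "v \<in> lists alphabet" using assms tri_in_lists by blast+
  then have *: "mval (u @ v) = mval u \<otimes> mval v" "mval u \<otimes> mval v \<in> carrier G" by simp_all
  show ?thesis
    unfolding *(1) using assms * by (intro tri_mult) simp_all
qed

lemma Tri_marker: "Tri [h]"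
  using tri_letter[of h alphabet mev bigball] by simp

lemma Tri_short:
  assumes "w \<in> lists S" "length w \<le> 1"
  shows "Tri w"
proof (cases w)
  case (Cons a v)
  then have w: "w = [a]" "a \<in> S" using assms by simp_all
  have "a \<noteq> h" using w h_notin by auto
  then have "mev a \<in> bigball" using len_le[of "[a]"] w ev_in[of a] by (simp add: mev_def)
  then show ?thesis using tri_letter[of a alphabet mev bigball] w mev_in[of a] by simp
qed (simp add: tri_empty)

text \<open>The two sides run apart from \<open>w\<close> like the rails of a ladder, and the
  hypothesis bounds the rungs. Adding a letter of \<open>u\<close> and then one of \<open>v\<close>
  cuts each square by a diagonal of length at most \<open>2 * K + 1\<close>.\<close>

lemma Tri_ladder:
  assumes "Tri w" "u \<in> lists S" "v \<in> lists S" "length u = length v"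
    and "\<And>i. i \<le> length u \<Longrightarrow> len (mval (drop (length u - i) u @ w @ take i v)) \<le> 2 * K"
  shows "Tri (u @ w @ v)"
  using assms(2-5)
proof (induction u arbitrary: v rule: list.induct)
  case (Cons a u)
  then obtain v' b where v: "v = v' @ [b]" by (cases v rule: rev_cases) auto
  have in_S: "a \<in> S" "u \<in> lists S" "v' \<in> lists S" "b \<in> S" using Cons.prems(1,2) v by simp_all
  have w: "w \<in> lists alphabet" using tri_in_lists[OF assms(1)] .
  have short: "len (mval (drop (length u - i) u @ w @ take i v')) \<le> 2 * K" if "i \<le> length u" for i
    using Cons.prems(4)[of i] that Cons.prems(3) v by (simp add: Suc_diff_le)
  have "Tri (u @ w @ v')"
    using Cons.prems(3) v short by (intro Cons.IH in_S) auto
  moreover have "Tri [a]" "Tri [b]" using in_S by (intro Tri_short; simp)+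
  moreover have "len (mval (u @ w @ v')) \<le> 2 * K"
    using short[of "length u"] Cons.prems(3) v by simp
  moreover have "mval ([a] @ u @ w @ v') = mval [a] \<otimes> mval (u @ w @ v')"
    using in_S w by (intro mval_append) auto
  moreover have "len (mval [a]) \<le> 1" "mval [a] \<in> carrier G" "mval (u @ w @ v') \<in> carrier G"
    using len_le[of "[a]"] in_S w by (simp_all del: word_ev_Cons)
  ultimately have "len (mval ([a] @ u @ w @ v')) \<le> 4 * K + 3" "Tri (u @ w @ v')" "Tri [a]" "Tri [b]"
    using len_mult[of "mval [a]" "mval (u @ w @ v')"] by simp_all
  note 1 = Tri_append[OF this(3,2,1)] this(4)
  have "len (mval (([a] @ u @ w @ v') @ [b])) \<le> 4 * K + 3"
    using Cons.prems(4)[of "length (a # u)"] v Cons.prems(3) by simp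
  then have "Tri (([a] @ u @ w @ v') @ [b])"
    by (rule Tri_append[OF 1])
  then show ?case using v by simp
qed (use assms in simp)

lemma take_drop_split: "i \<le> j \<Longrightarrow> xs = take i xs @ drop i (take j xs) @ drop j xs"
  by (metis append.assoc append_take_drop_id min.absorb1 take_take)

lemma Tri_corner:
  assumes "geodesic_word u" "geodesic_word v" "i \<le> length u" "i \<le> length v"
    and "2 * i + len (val u \<otimes> val v) \<le> length u + length v"
  shows "Tri (drop (length u - i) u @ [h] @ take i v)"
    and "len (mval (drop (length u - i) u @ [h] @ take i v)) \<le> 2 * K"
proof -
  have w: "u \<in> lists S" "v \<in> lists S" using assms by (auto simp: geodesic_word_def)
  have short: "len (mval (drop (length u - k) u @ [h] @ take k v)) \<le> 2 * K" if "k \<le> i" for k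
    using corner_close[OF assms(1,2), of k] assms(3-5) that w by simp
  show "len (mval (drop (length u - i) u @ [h] @ take i v)) \<le> 2 * K" using short by simp
  show "Tri (drop (length u - i) u @ [h] @ take i v)"
  proof (rule Tri_ladder[OF Tri_marker])
    fix k assume k: "k \<le> length (drop (length u - i) u)"
    then have "k \<le> i" using assms(3) by simp
    moreover have "drop (length (drop (length u - i) u) - k) (drop (length u - i) u) = drop (length u - k) u"
      using \<open>k \<le> i\<close> assms(3) by simp
    moreover have "take k (take i v) = take k v" using \<open>k \<le> i\<close> by simp
    ultimately show "len (mval (drop (length (drop (length u - i) u) - k) (drop (length u - i) u) @ [h] @ take k (take i v))) \<le> 2 * K"
      using short by presburger
  qed (use w assms in auto)
qed

text \<open>The tripod decomposition. The word starts and ends at the corner between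
  \<open>w\<close> and \<open>u\<close>, so the disc is built outward from the two marked corners:
  \<open>Y\<close> joins these with the leftover letters in the middle of the sides, and a last
  ladder around \<open>Y\<close> absorbs the third corner.\<close>

lemma Tri_geodesic_triangle:
  assumes geo: "geodesic_word u" "geodesic_word v" "geodesic_word w"
    and closed: "val u \<otimes> val v \<otimes> val w = \<one>"
  shows "Tri (u @ [h] @ v @ [h] @ w)"
proof -
  have W: "u \<in> lists S" "v \<in> lists S" "w \<in> lists S" "len (val u) = length u"
    "len (val v) = length v" "len (val w) = length w"
    using geo by (auto simp: geodesic_word_def)
  define x y z where "x = val u" and "y = val v" and "z = val w"
  have V: "x \<in> carrier G" "y \<in> carrier G" "z \<in> carrier G" "x \<otimes> y \<otimes> z = \<one>"
    using W closed by (simp_all add: x_def y_def z_def)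
  have "x \<otimes> y = inv z" using V by (metis inv_equality inv_inv m_closed)
  then have xy: "len (x \<otimes> y) = length w" using V W by (simp add: z_def)
  have yz_eq: "y \<otimes> z = inv x" using V by (metis inv_equality inv_comm m_assoc m_closed)
  then have yz: "len (y \<otimes> z) = length u" using V W by (simp add: x_def)
  have "y \<otimes> (z \<otimes> x) = \<one>" using V yz_eq by (simp flip: m_assoc)
  then have "z \<otimes> x = inv y" using V by (metis inv_equality inv_comm m_closed)
  then have zx: "len (z \<otimes> x) = length v" using V W by (simp add: y_def)
  have le: "length w \<le> length u + length v" "length u \<le> length v + length w" "length v \<le> length w + length u"
    using len_mult[of x y] len_mult[of y z] len_mult[of z x] xy yz zx V W by (simp_all add: x_def y_def z_def)
  \<comment> \<open>The Gromov products at the three corners, rounded down; at most one letter then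
    remains in the middle of each side.\<close>
  define i j k where "i = (length u + length v - length w) div 2"
    and "j = (length v + length w - length u) div 2" and "k = (length w + length u - length v) div 2"
  have ijk: "i \<le> length u" "i \<le> length v" "j \<le> length v" "j \<le> length w" "k \<le> length w" "k \<le> length u"
    "2 * i + length w \<le> length u + length v" "2 * j + length u \<le> length v + length w"
    "2 * k + length v \<le> length w + length u"
    "k \<le> length u - i" "length u - i \<le> k + 1" "i \<le> length v - j" "length v - j \<le> i + 1"
    "j \<le> length w - k" "length w - k \<le> j + 1"
    using le unfolding i_def j_def k_def by linarith+
  define m1 where "m1 = drop k (take (length u - i) u)"
  define m2 where "m2 = drop i (take (length v - j) v)"
  define m3 where "m3 = drop j (take (length w - k) w)"
  define c1 where "c1 = drop (length u - i) u @ [h] @ take i v"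
  define c2 where "c2 = drop (length v - j) v @ [h] @ take j w"
  define Y where "Y = m1 @ c1 @ m2 @ c2 @ m3"
  have m_in: "m1 \<in> lists S" "m2 \<in> lists S" "m3 \<in> lists S"
    using W unfolding m1_def m2_def m3_def by simp_all
  have m_len: "length m1 \<le> 1" "length m2 \<le> 1" "length m3 \<le> 1"
    using ijk unfolding m1_def m2_def m3_def by simp_all
  have len_m: "len (mval m1) \<le> 1" "len (mval m2) \<le> 1" "len (mval m3) \<le> 1"
    using m_in m_len len_le[OF m_in(1)] len_le[OF m_in(2)] len_le[OF m_in(3)] by simp_all
  have c: "Tri c1" "len (mval c1) \<le> 2 * K" "Tri c2" "len (mval c2) \<le> 2 * K"
    using Tri_corner[OF geo(1,2) ijk(1,2)] Tri_corner[OF geo(2,3) ijk(3,4)] ijk xy yz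
    unfolding c1_def c2_def x_def y_def z_def by simp_all
  have c_in: "c1 \<in> lists alphabet" "c2 \<in> lists alphabet" using c tri_in_lists by blast+
  have len_app: "len (mval (p @ q)) \<le> len (mval p) + len (mval q)"
    if "p \<in> lists alphabet" "q \<in> lists alphabet" for p q
    using that len_mult[of "mval p" "mval q"] by simp
  note ins = m_in[THEN lists_alphabet] c_in
  have l1: "len (mval (c2 @ m3)) \<le> 2 * K + 1" using len_app[of c2 m3] ins c len_m by simp
  have l2: "len (mval (m2 @ c2 @ m3)) \<le> 2 * K + 2" using len_app[of m2 "c2 @ m3"] ins l1 len_m by simp
  have l3: "len (mval (c1 @ m2 @ c2 @ m3)) \<le> 4 * K + 2" using len_app[of c1 "m2 @ c2 @ m3"] ins l2 c by simp
  have l4: "len (mval (m1 @ c1 @ m2 @ c2 @ m3)) \<le> 4 * K + 3"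
    using len_app[of m1 "c1 @ m2 @ c2 @ m3"] ins l3 len_m by simp
  have "Tri m1" "Tri m2" "Tri m3" using Tri_short m_in m_len by blast+
  then have TY: "Tri Y"
    unfolding Y_def using c l1 l2 l3 l4 by (intro Tri_append) simp_all
  have whole: "u @ [h] @ v @ [h] @ w = take k u @ Y @ drop (length w - k) w"
  proof -
    have "u = take k u @ m1 @ drop (length u - i) u" "v = take i v @ m2 @ drop (length v - j) v"
      "w = take j w @ m3 @ drop (length w - k) w"
      unfolding m1_def m2_def m3_def using ijk by (intro take_drop_split; simp)+
    then show ?thesis unfolding Y_def c1_def c2_def by (metis append.assoc)
  qed
  have Y_in: "Y \<in> lists alphabet" using TY tri_in_lists by blast
  have "Tri (take k u @ Y @ drop (length w - k) w)"
  proof (rule Tri_ladder[OF TY])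
    fix l assume "l \<le> length (take k u)"
    then have l: "l \<le> k" using ijk by simp
    define n where "n = k - l"
    define q where "q = drop n (take k u) @ Y @ take l (drop (length w - k) w)"
    have q_in: "q \<in> lists alphabet" using W Y_in by (simp add: q_def)
    have "take n u @ q @ drop (length w - n) w = u @ [h] @ v @ [h] @ w"
    proof -
      have "length w - n = l + (length w - k)" using l ijk by (simp add: n_def)
      then have "drop l (drop (length w - k) w) = drop (length w - n) w" by simp
      then have "drop (length w - k) w = take l (drop (length w - k) w) @ drop (length w - n) w"
        by (metis append_take_drop_id)
      moreover have "take k u = take n u @ drop n (take k u)"
        using append_take_drop_id[of n "take k u"] by (simp add: n_def)
      ultimately show ?thesis unfolding whole q_def by (metis append.assoc)
    qed
    moreover have "mval (u @ [h] @ v @ [h] @ w) = \<one>" using mval_triangle W closed by simp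
    ultimately have "mval (take n u @ q @ drop (length w - n) w) = \<one>" by (simp only:)
    \<comment> \<open>The rung is measured from outside: rotating the closed loop shows that
      \<open>mval q\<close> is the inverse of the value read across the third corner, to which
      \<open>corner_close\<close> for \<open>w\<close> and \<open>u\<close> applies.\<close>
    then have "val (take n u) \<otimes> (mval q \<otimes> val (drop (length w - n) w)) = \<one>"
      using W q_in by simp
    then have "(mval q \<otimes> val (drop (length w - n) w)) \<otimes> val (take n u) = \<one>"
      using W q_in inv_comm by simp
    then have "mval q \<otimes> (val (drop (length w - n) w) \<otimes> val (take n u)) = \<one>"
      using W q_in by (simp add: m_assoc)
    then have "mval q = inv (val (drop (length w - n) w) \<otimes> val (take n u))"
      using W q_in by (metis inv_equality m_closed mval_in val_in take_in drop_in)
    then have "len (mval q) = len (val (drop (length w - n) w) \<otimes> val (take n u))"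
      using W by simp
    also have "\<dots> \<le> 2 * K"
      using corner_close[OF geo(3,1), of n] ijk zx by (simp add: n_def x_def z_def)
    finally have "len (mval q) \<le> 2 * K" .
    moreover have "length (take k u) - l = n" using ijk by (simp add: n_def)
    ultimately show "len (mval (drop (length (take k u) - l) (take k u) @ Y @ take l (drop (length w - k) w))) \<le> 2 * K"
      unfolding q_def by simp
  qed (use W ijk in auto)
  then show ?thesis unfolding whole .
qed

theorem geodesics_regular_combing_context_free:
  "\<exists>R. R \<subseteq> lists S \<and> val ` R = carrier G \<and> regular_lang S R \<and> context_free alphabet (triangles R)"
proof -
  define R where "R = {w. geodesic_word w}"
  have R_lists: "R \<subseteq> lists S" by (auto simp: R_def geodesic_word_def)
  have "val ` R = carrier G"
  proof
    show "val ` R \<subseteq> carrier G" using R_lists by auto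
    show "carrier G \<subseteq> val ` R"
    proof
      fix g assume "g \<in> carrier G"
      then obtain w where "w \<in> lists S" "length w = len g" "val w = g" using shortest_word by blast
      then show "g \<in> val ` R" by (auto simp: R_def geodesic_word_def)
    qed
  qed
  moreover have fin: "finite (quotients S R)" using finite_quotients_geodesic by (simp add: R_def)
  then have "regular_lang S R" using R_lists by (rule regular_lang_if_finite_quotients[rotated])
  moreover have "context_free alphabet (triangles R)"
  proof -
    define L where "L = marked_conc h R (marked_conc h R R)"
    have L: "L = {u @ [h] @ v @ [h] @ w | u v w. u \<in> R \<and> v \<in> R \<and> w \<in> R}"
      unfolding L_def marked_conc_def by auto
    have "finite (quotients alphabet L)"
      unfolding L_def using R_lists fin h_notin
      by (intro finite_quotients_marked_conc finite_quotients_insert)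
    then have "context_free alphabet {w \<in> L. tri alphabet mev bigball w \<one>}"
      using finite_ball finite_gens by (intro context_free_tri) simp_all
    moreover have "{w \<in> L. tri alphabet mev bigball w \<one>} = triangles R"
    proof (intro Set.set_eqI iffI)
      fix t assume "t \<in> {w \<in> L. tri alphabet mev bigball w \<one>}"
      then obtain u v w where t: "t = u @ [h] @ v @ [h] @ w" "u \<in> R" "v \<in> R" "w \<in> R"
        "tri alphabet mev bigball t \<one>" unfolding L by blast
      then have "mval t = \<one>" using tri_value mev_in by blast
      moreover have "u \<in> lists S" "v \<in> lists S" "w \<in> lists S" using t R_lists by blast+
      ultimately have "val u \<otimes> val v \<otimes> val w = \<one>" using mval_triangle[of u v w] t(1) by simp
      with t show "t \<in> triangles R" unfolding triangles_def by blast
    next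
      fix t assume "t \<in> triangles R"
      then obtain u v w where t: "t = u @ [h] @ v @ [h] @ w" "u \<in> R" "v \<in> R" "w \<in> R"
        "val u \<otimes> val v \<otimes> val w = \<one>" unfolding triangles_def by blast
      moreover have "u \<in> lists S" "v \<in> lists S" "w \<in> lists S" using t R_lists by blast+
      ultimately have "mval t = \<one>" using mval_triangle[of u v w] by simp
      moreover have "Tri t" unfolding t(1) using t by (intro Tri_geodesic_triangle) (simp_all add: R_def)
      ultimately show "t \<in> {w \<in> L. tri alphabet mev bigball w \<one>}" using t unfolding L by auto
    qed
    ultimately show ?thesis by simp
  qed
  ultimately show ?thesis using R_lists by blast
qed

end

section \<open>Triangles generated by a grammar are thin\<close>

lemma append_eq_marked_cases:
  assumes "h \<notin> set z" "l @ z @ r = u @ h # y"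
  shows "(\<exists>r1. u = l @ z @ r1 \<and> r = r1 @ h # y) \<or> (\<exists>l1. l = u @ h # l1 \<and> y = l1 @ z @ r)"
proof -
  from assms(2) consider us where "l = u @ us" "us @ z @ r = h # y" | us where "l @ us = u" "z @ r = us @ h # y"
    by (auto simp: append_eq_append_conv2)
  then show ?thesis
  proof cases
    case 1
    show ?thesis
    proof (cases us)
      case Nil
      with 1 assms(1) show ?thesis by (cases z) auto
    next
      case (Cons a l1)
      with 1 show ?thesis by auto
    qed
  next
    case 2
    from 2(2) consider ts where "z = us @ ts" "ts @ r = h # y" | ts where "z @ ts = us" "r = ts @ h # y"
      by (auto simp: append_eq_append_conv2)
    then show ?thesis
    proof cases
      case 1
      with assms(1) 2 show ?thesis by (cases ts) auto
    qed (use 2 in auto)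
  qed
qed

lemma concat_position:
  "zs \<noteq> [] \<Longrightarrow> q \<le> length (concat zs) \<Longrightarrow>
    \<exists>zl z zr. zs = zl @ z # zr \<and> length (concat zl) \<le> q \<and> q \<le> length (concat zl) + length z"
proof (induction zs arbitrary: q)
  case (Cons y ys)
  show ?case
  proof (cases "q \<le> length y")
    case True
    then show ?thesis by (intro exI[of _ "[]"] exI[of _ y] exI[of _ ys]) simp
  next
    case False
    with Cons.prems have "ys \<noteq> []" "q - length y \<le> length (concat ys)" by auto
    then obtain zl z zr where "ys = zl @ z # zr" "length (concat zl) \<le> q - length y"
      "q - length y \<le> length (concat zl) + length z" using Cons.IH by blast
    with False show ?thesis by (intro exI[of _ "y # zl"] exI[of _ z] exI[of _ zr]) auto
  qed
qed simp

lemma length_concat_le: "(\<And>z. z \<in> set zs \<Longrightarrow> length z \<le> k) \<Longrightarrow> length (concat zs) \<le> length zs * k"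
  by (induction zs) (simp_all add: add_le_mono)

lemma yields_in_lists:
  assumes "yields P s z" "\<And>X \<alpha> a. (X, \<alpha>) \<in> P \<Longrightarrow> Inr a \<in> set \<alpha> \<Longrightarrow> a \<in> A"
  shows "s \<in> range Inl \<union> Inr ` A \<Longrightarrow> z \<in> lists A"
  using assms(1)
proof (induction rule: yields.induct)
  case (rule X \<alpha> zs)
  have "s \<in> range Inl \<union> Inr ` A" if "s \<in> set \<alpha>" for s
    using assms(2)[OF rule(1)] that by (cases s) auto
  with rule(2) have "\<forall>z\<in>set zs. z \<in> lists A"
    unfolding list_all2_conv_all_nth by (metis in_set_conv_nth)
  then show ?case unfolding in_lists_conv_set by auto
qed auto

context marked_group
begin

lemma len_mval_le: "w \<in> lists alphabet \<Longrightarrow> len (mval w) \<le> length w"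
proof (induction w rule: list.induct)
  case (Cons a w)
  then have a: "a \<in> alphabet" "w \<in> lists alphabet" by simp_all
  then have "len (mev a) \<le> 1" using len_le[of "[a]"] ev_in[of a] by (cases "a = h") (simp_all add: mev_def)
  then show ?case using len_mult[of "mev a" "mval w"] Cons.IH a mev_in[OF a(1)] by simp
qed simp

lemma dist_mval_append:
  "u \<in> lists alphabet \<Longrightarrow> v \<in> lists alphabet \<Longrightarrow> dist (mval u) (mval (u @ v)) = len (mval v)"
  by (simp add: dist_eq inv_mult_cancel)

lemma dist_mval_take:
  assumes "w \<in> lists alphabet" "i \<le> j"
  shows "dist (mval (take i w)) (mval (take j w)) \<le> j - i"
proof -
  have "take j w = take i w @ drop i (take j w)"
    using assms(2) by (metis append_take_drop_id min.absorb1 take_take)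
  moreover have "take i w \<in> lists alphabet" "drop i (take j w) \<in> lists alphabet"
    using assms(1) by (auto dest: in_set_takeD in_set_dropD)
  ultimately have "dist (mval (take i w)) (mval (take j w)) = len (mval (drop i (take j w)))"
    using dist_mval_append by metis
  also have "\<dots> \<le> length (drop i (take j w))" using len_mval_le \<open>drop i (take j w) \<in> lists alphabet\<close> .
  finally show ?thesis by simp
qed

end

locale combing_grammar = marked_group G S iv ev h
  for G (structure) and S :: "'s set" and iv ev h +
  fixes R :: "'s list set" and P :: "(nat \<times> (nat + 's) list) set" and X0 :: nat
  assumes R_lists: "R \<subseteq> lists S"
    and R_surj: "val ` R = carrier G"
    and finite_P: "finite P"
    and P_alphabet: "(X, \<alpha>) \<in> P \<Longrightarrow> Inr a \<in> set \<alpha> \<Longrightarrow> a \<in> alphabet"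
    and triangles_eq: "triangles R = {w \<in> lists alphabet. (cfg_step P)\<^sup>*\<^sup>* [Inl X0] (map Inr w)}"
begin

text \<open>Minimality is within \<open>R\<close> only, so such a word may be much longer than
  \<open>len (val u)\<close>.\<close>

definition shortest :: "'s list \<Rightarrow> bool" where
  "shortest u \<longleftrightarrow> u \<in> R \<and> (\<forall>u'\<in>R. val u' = val u \<longrightarrow> length u \<le> length u')"

lemma shortest_in: "shortest u \<Longrightarrow> u \<in> lists S"
  using R_lists by (auto simp: shortest_def)

lemma shortest_exists: "g \<in> carrier G \<Longrightarrow> \<exists>u. shortest u \<and> val u = g"
proof -
  assume "g \<in> carrier G"
  then have "g \<in> val ` R" using R_surj by simp
  then obtain u0 where "u0 \<in> R \<and> val u0 = g" by blast
  from ex_has_least_nat[of "\<lambda>u. u \<in> R \<and> val u = g", OF this, of length] show ?thesis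
    unfolding shortest_def by blast
qed

text \<open>A node of a parse tree seen from outside: its symbol stands in a sentential form whose
  other branches are fully expanded.\<close>

definition in_context :: "'s list \<Rightarrow> nat + 's \<Rightarrow> 's list \<Rightarrow> bool" where
  "in_context l s r \<longleftrightarrow> (cfg_step P)\<^sup>*\<^sup>* [Inl X0] (map Inr l @ [s] @ map Inr r)"

lemma in_context_yield:
  assumes "in_context l s r" "yields P s z" "l @ z @ r \<in> lists alphabet"
  shows "l @ z @ r \<in> triangles R"
proof -
  have "(cfg_step P)\<^sup>*\<^sup>* (map Inr l @ [s] @ map Inr r) (map Inr l @ map Inr z @ map Inr r)"
    by (intro derives_context yields_imp_derives assms)
  with assms show ?thesis unfolding triangles_eq in_context_def by auto
qed

text \<open>Both triangles contain exactly two markers and \<open>z\<close> contains none, so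
  \<open>z'\<close> contains none either. The exchange therefore takes place inside one side and
  leaves the other two alone; the new side lies in \<open>R\<close> with the same value, so it is
  not shorter.\<close>

lemma replacement_not_shorter:
  assumes "shortest u" "shortest v" "shortest w"
    and "u @ [h] @ v @ [h] @ w = l @ z @ r" and "l @ z' @ r \<in> triangles R"
    and "h \<notin> set z" and "z \<in> lists alphabet" "z' \<in> lists alphabet" and "mval z' = mval z"
  shows "length z \<le> length z'"
proof -
  obtain u' v' w' where W': "l @ z' @ r = u' @ [h] @ v' @ [h] @ w'" "u' \<in> R" "v' \<in> R" "w' \<in> R"
    using assms(5) unfolding triangles_def by blast
  have "u \<in> lists S" "v \<in> lists S" "w \<in> lists S" "u' \<in> lists S" "v' \<in> lists S" "w' \<in> lists S"
    using assms(1-3) shortest_in W' R_lists by blast+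
  then have no_h: "h \<notin> set u" "h \<notin> set v" "h \<notin> set w" "h \<notin> set u'" "h \<notin> set v'" "h \<notin> set w'"
    using h_notin by auto
  have "count_list (l @ z @ r) h = 2"
    unfolding assms(4)[symmetric] using no_h by (simp add: count_list_0_iff)
  moreover have "count_list (l @ z' @ r) h = 2"
    unfolding W'(1) using no_h by (simp add: count_list_0_iff)
  moreover have "count_list z h = 0" using assms(6) by (simp add: count_list_0_iff)
  ultimately have "count_list z' h = 0" by simp
  then have z'_h: "h \<notin> set z'" by (simp add: count_list_0_iff)
  then have zS: "z \<in> lists S" "z' \<in> lists S" using assms(6-8) by auto
  have side: "length z \<le> length z'" if "shortest t" "t = a @ z @ b" "a @ z' @ b \<in> R" for t a b
  proof -
    have ab: "a \<in> lists S" "b \<in> lists S" using shortest_in[OF that(1)] that(2) by simp_all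
    have "val (a @ z' @ b) = val t"
      unfolding that(2) using ab zS assms(9) by simp
    then have "length t \<le> length (a @ z' @ b)" using that(1,3) unfolding shortest_def by blast
    then show ?thesis using that(2) by simp
  qed
  have "l @ z @ r = u @ h # (v @ h # w)" using assms(4) by simp
  from append_eq_marked_cases[OF assms(6) this] show ?thesis
  proof (elim disjE exE conjE)
    fix r1 assume r1: "u = l @ z @ r1" "r = r1 @ h # v @ h # w"
    then have "(l @ z' @ r1) @ h # (v @ h # w) = u' @ h # (v' @ h # w')" using W'(1) by simp
    then have "l @ z' @ r1 = u'"
      using append_marker_eq[of h "l @ z' @ r1" u'] no_h z'_h r1(1) by simp
    then show ?thesis using side[OF assms(1) r1(1)] W' by simp
  next
    fix l1 assume l1: "l = u @ h # l1" "v @ h # w = l1 @ z @ r"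
    then have "u @ h # (l1 @ z' @ r) = u' @ h # (v' @ h # w')" using W'(1) by simp
    then have rest: "l1 @ z' @ r = v' @ h # w'" using append_marker_eq[of h u u'] no_h by simp
    from append_eq_marked_cases[OF assms(6) l1(2)[symmetric]] show ?thesis
    proof (elim disjE exE conjE)
      fix r1 assume r1: "v = l1 @ z @ r1" "r = r1 @ h # w"
      then have "(l1 @ z' @ r1) @ h # w = v' @ h # w'" using rest by simp
      then have "l1 @ z' @ r1 = v'"
        using append_marker_eq[of h "l1 @ z' @ r1" v'] no_h z'_h r1(1) by simp
      then show ?thesis using side[OF assms(2) r1(1)] W' by simp
    next
      fix l2 assume l2: "l1 = v @ h # l2" "w = l2 @ z @ r"
      then have "v @ h # (l2 @ z' @ r) = v' @ h # w'" using rest by simp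
      then have "l2 @ z' @ r = w'" using append_marker_eq[of h v v'] no_h by simp
      then show ?thesis using side[OF assms(3) l2(2)] W' by simp
    qed
  qed
qed

text \<open>Only the finitely many left-hand sides of rules have yields, and one yield is chosen for
  each. The successor makes the bound positive, so that it also covers single letters.\<close>

lemma bounded_yields: "\<exists>K>0. \<forall>X z. yields P (Inl X) z \<longrightarrow> (\<exists>z'. yields P (Inl X) z' \<and> length z' \<le> K)"
proof -
  define m where "m X = length (SOME z. yields P (Inl X) z)" for X
  have "\<exists>z'. yields P (Inl X) z' \<and> length z' \<le> Suc (sum m (fst ` P))" if "yields P (Inl X) z" for X z
  proof -
    have "X \<in> fst ` P" using that by (cases rule: yields.cases) force
    then have "m X \<le> sum m (fst ` P)" using finite_P by (intro member_le_sum) auto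
    moreover have "yields P (Inl X) (SOME z. yields P (Inl X) z)" using that by (rule someI)
    ultimately show ?thesis unfolding m_def by (metis le_SucI)
  qed
  then show ?thesis by blast
qed

text \<open>Replacing the yield of a node by another one leads to another triangle with the same value.\<close>

lemma node_bound:
  assumes K: "K > 0" "\<forall>X z. yields P (Inl X) z \<longrightarrow> (\<exists>z'. yields P (Inl X) z' \<and> length z' \<le> K)"
    and short: "shortest u" "shortest v" "shortest w"
    and W: "u @ [h] @ v @ [h] @ w = l @ z @ r" "l @ z @ r \<in> triangles R"
    and s: "in_context l s r" "yields P s z"
  shows "len (mval z) \<le> K \<and> (h \<notin> set z \<longrightarrow> length z \<le> K)"
proof -
  have lzr: "l \<in> lists alphabet" "z \<in> lists alphabet" "r \<in> lists alphabet"
    using W(2) unfolding triangles_eq by simp_all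
  show ?thesis
  proof (cases s)
    case (Inr a)
    then have "z = [a]" using s(2) by (auto elim: yields.cases)
    then show ?thesis using len_mval_le[OF lzr(2)] K(1) by auto
  next
    case (Inl X)
    then obtain z' where z': "yields P s z'" "length z' \<le> K" using K(2) s(2) by blast
    have z'_in: "z' \<in> lists alphabet"
      using yields_in_lists[OF z'(1), of alphabet] P_alphabet Inl by blast
    then have W': "l @ z' @ r \<in> triangles R" using in_context_yield[OF s(1) z'(1)] lzr by simp
    have closed: "mval t = \<one>" if t_in: "t \<in> triangles R" for t
    proof -
      obtain u v w where t: "t = u @ [h] @ v @ [h] @ w" "u \<in> R" "v \<in> R" "w \<in> R" "val u \<otimes> val v \<otimes> val w = \<one>"
        using t_in unfolding triangles_def by blast
      then have "u \<in> lists S" "v \<in> lists S" "w \<in> lists S" using R_lists by blast+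
      then show ?thesis using mval_triangle[of u v w] t by simp
    qed
    have "mval l \<otimes> (mval z \<otimes> mval r) = mval l \<otimes> (mval z' \<otimes> mval r)"
      using closed[OF W(2)] closed[OF W'] lzr z'_in by simp
    then have eq: "mval z' = mval z" using lzr z'_in by simp
    have "len (mval z) \<le> K" using len_mval_le[OF z'_in] z'(2) eq by simp
    moreover have "length z \<le> K" if "h \<notin> set z"
      using replacement_not_shorter[OF short W(1) W' that lzr(2) z'_in eq] z'(2) by simp
    ultimately show ?thesis by blast
  qed
qed

text \<open>The number of markers in a prefix of a triangle tells on which side the prefix ends. Given a
  point, descend in the parse tree to the smallest node around it that contains a marker: the point
  is then in a marker-free, hence short, piece of one of the children, and separated from a marked
  child, whose two ends are close together but on different sides, by short pieces only.\<close>

lemma triangle_thin: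
  "\<exists>D. \<forall>u v w p. shortest u \<longrightarrow> shortest v \<longrightarrow> shortest w \<longrightarrow> val u \<otimes> val v \<otimes> val w = \<one> \<longrightarrow>
    p \<le> length (u @ [h] @ v @ [h] @ w) \<longrightarrow>
    (\<exists>p' \<le> length (u @ [h] @ v @ [h] @ w).
       count_list (take p' (u @ [h] @ v @ [h] @ w)) h \<noteq> count_list (take p (u @ [h] @ v @ [h] @ w)) h \<and>
       dist (mval (take p (u @ [h] @ v @ [h] @ w))) (mval (take p' (u @ [h] @ v @ [h] @ w))) \<le> D)"
proof -
  obtain K where K: "K > 0" "\<forall>X z. yields P (Inl X) z \<longrightarrow> (\<exists>z'. yields P (Inl X) z' \<and> length z' \<le> K)"
    using bounded_yields by blast
  obtain B where B: "\<And>X \<alpha>. (X, \<alpha>) \<in> P \<Longrightarrow> length \<alpha> \<le> B"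
  proof
    fix X \<alpha> assume "(X, \<alpha>) \<in> P"
    then show "length \<alpha> \<le> (\<Sum>(X, \<alpha>)\<in>P. length \<alpha>)"
      using member_le_sum[of "(X, \<alpha>)" P "\<lambda>(X, \<alpha>). length \<alpha>"] finite_P by simp
  qed
  \<comment> \<open>At most \<open>B\<close> marker-free pieces of length at most \<open>K\<close>
    separate \<open>p\<close> from a marked child; the last \<open>K\<close> is for crossing that
    child.\<close>
  define D where "D = B * K + K"
  have "\<exists>p' \<le> length W. count_list (take p' W) h \<noteq> count_list (take p W) h \<and>
      dist (mval (take p W)) (mval (take p' W)) \<le> D" (is "?good")
    if short: "shortest u" "shortest v" "shortest w" and closed: "val u \<otimes> val v \<otimes> val w = \<one>"
      and W_def: "W = u @ [h] @ v @ [h] @ w" and p: "p \<le> length W" for u v w W p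
  proof -
    have W_tri: "W \<in> triangles R" using short closed unfolding W_def triangles_def shortest_def by blast
    then have W_in: "W \<in> lists alphabet" unfolding triangles_eq by blast
    have W_ctx: "l @ z @ r \<in> triangles R" "u @ [h] @ v @ [h] @ w = l @ z @ r" if "W = l @ z @ r" for l z r
      using W_tri that W_def by simp_all
    have take_in: "mval (take q W) \<in> carrier G" for q
      using W_in by (intro mval_in) (auto dest: in_set_takeD)
    have count_mono: "count_list (take i W) h \<le> count_list (take j W) h" if "i \<le> j" for i j
    proof -
      have "take j W = take i W @ drop i (take j W)"
        using that by (metis append_take_drop_id min.absorb1 take_take)
      then show ?thesis by (metis count_list_append le_add1)
    qed
    have "in_context l s r \<longrightarrow> W = l @ z @ r \<longrightarrow> h \<in> set z \<longrightarrow> length l \<le> p \<longrightarrow> p \<le> length l + length z \<longrightarrow> ?good"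
      if "yields P s z" for s z l r
      using that
    proof (induction arbitrary: l r rule: yields.induct)
      case (letter a)
      show ?case
      proof (intro impI)
        assume W: "W = l @ [a] @ r" and "h \<in> set [a]" and p: "length l \<le> p" "p \<le> length l + length [a]"
        then have a: "a = h" by simp
        have l_in: "l \<in> lists alphabet" using W W_in by simp
        \<comment> \<open>At a leaf the marker itself is crossed: its two ends have the same value
          but different counts.\<close>
        then have same: "mval (l @ [h]) = mval l" by simp
        have zero: "dist (mval l) (mval l) = 0" using l_in by (simp add: dist_eq)
        have takes: "take (length l) W = l" "take (length l + 1) W = l @ [h]" using W a by simp_all
        have len_W: "length l + 1 \<le> length W" using W by simp
        consider "p = length l" | "p = length l + 1" using p by fastforce
        then show ?good
        proof cases
          case 1
          then show ?good
            using takes same zero len_W by (intro exI[of _ "length l + 1"]) simp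
        next
          case 2
          then show ?good
            using takes same zero len_W by (intro exI[of _ "length l"]) simp
        qed
      qed
    next
      case (rule X \<alpha> zs)
      show ?case
      proof (intro impI)
        assume ctx: "in_context l (Inl X) r" and W: "W = l @ concat zs @ r" and hz: "h \<in> set (concat zs)"
          and p: "length l \<le> p" "p \<le> length l + length (concat zs)"
        \<comment> \<open>\<open>Q\<close> bundles the tree of a child with its induction
          hypothesis, so that both survive splitting the list of children.\<close>
        define Q where "Q s z \<longleftrightarrow> yields P s z \<and> (\<forall>l r. in_context l s r \<longrightarrow> W = l @ z @ r \<longrightarrow> h \<in> set z \<longrightarrow>
          length l \<le> p \<longrightarrow> p \<le> length l + length z \<longrightarrow> ?good)" for s z
        have Q: "list_all2 Q \<alpha> zs" unfolding Q_def by (rule list_all2_mono[OF rule(2)]) blast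
        have node: "\<exists>s. yields P s z \<and> in_context (l @ concat za) s (concat zb @ r) \<and>
            (\<forall>l r. in_context l s r \<longrightarrow> W = l @ z @ r \<longrightarrow> h \<in> set z \<longrightarrow> length l \<le> p \<longrightarrow>
              p \<le> length l + length z \<longrightarrow> ?good)"
          if zs: "zs = za @ z # zb" for za z zb
        proof -
          obtain \<alpha>a s \<alpha>b where \<alpha>: "\<alpha> = \<alpha>a @ s # \<alpha>b" "list_all2 Q \<alpha>a za" "list_all2 Q \<alpha>b zb" "Q s z"
            using Q unfolding zs by (auto simp: list_all2_append2 list_all2_Cons2)
          have derives: "list_all2 (\<lambda>s z. (cfg_step P)\<^sup>*\<^sup>* [s] (map Inr z)) \<beta> ys" if "list_all2 Q \<beta> ys" for \<beta> ys
            using that by (rule list_all2_mono) (simp add: Q_def yields_imp_derives)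
          have "(cfg_step P)\<^sup>*\<^sup>* \<alpha>a (map Inr (concat za))" "(cfg_step P)\<^sup>*\<^sup>* \<alpha>b (map Inr (concat zb))"
            by (intro derives_list derives \<alpha>)+
          then have "(cfg_step P)\<^sup>*\<^sup>* (\<alpha>a @ [s] @ \<alpha>b) (map Inr (concat za) @ [s] @ map Inr (concat zb))"
            by (intro derives_append) auto
          then have "(cfg_step P)\<^sup>*\<^sup>* [Inl X] (map Inr (concat za) @ [s] @ map Inr (concat zb))"
            using cfg_step_rule[OF rule(1)] \<alpha>(1) by (simp add: converse_rtranclp_into_rtranclp)
          from derives_context[OF this, of "map Inr l" "map Inr r"] ctx
          have "in_context (l @ concat za) s (concat zb @ r)"
            unfolding in_context_def by simp
          with \<alpha>(4) show ?thesis unfolding Q_def by blast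
        qed
        have bound: "len (mval z) \<le> K \<and> (h \<notin> set z \<longrightarrow> length z \<le> K)" if zs: "zs = za @ z # zb" for za z zb
        proof -
          have W': "W = (l @ concat za) @ z @ (concat zb @ r)" using W zs by simp
          obtain s where "yields P s z" "in_context (l @ concat za) s (concat zb @ r)" using node[OF zs] by blast
          then show ?thesis using node_bound[OF K short W_ctx(2,1)[OF W']] by blast
        qed
        have bound_elem: "length z \<le> K" if "z \<in> set zs" "h \<notin> set z" for z
          using that bound by (meson split_list)
        have len_zs: "length zs \<le> B" using B[OF rule(1)] rule(2) by (simp add: list_all2_lengthD)
        have piece: "length (concat ys) \<le> B * K"
          if "set ys \<subseteq> set zs" "length ys \<le> length zs" "\<And>y. y \<in> set ys \<Longrightarrow> h \<notin> set y" for ys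
        proof -
          have "length (concat ys) \<le> length ys * K"
            using that bound_elem by (intro length_concat_le) blast
          also have "\<dots> \<le> B * K" using that(2) len_zs by simp
          finally show ?thesis .
        qed
        have "zs \<noteq> []" using hz by auto
        moreover have "p - length l \<le> length (concat zs)" using p by simp
        ultimately obtain zl z zr where z: "zs = zl @ z # zr" "length (concat zl) \<le> p - length l"
          "p - length l \<le> length (concat zl) + length z"
          using concat_position by metis
        consider "h \<in> set z" | "h \<notin> set z" "h \<in> set (concat zr)" | "h \<notin> set z" "h \<in> set (concat zl)"
          using hz z(1) by auto
        then show ?good
        proof cases
          case 1
          obtain s where "in_context (l @ concat zl) s (concat zr @ r)"
            and IH: "\<forall>l r. in_context l s r \<longrightarrow> W = l @ z @ r \<longrightarrow> h \<in> set z \<longrightarrow> length l \<le> p \<longrightarrow>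
              p \<le> length l + length z \<longrightarrow> ?good"
            using node[OF z(1)] by blast
          moreover have "W = (l @ concat zl) @ z @ (concat zr @ r)" using W z(1) by simp
          moreover have "length (l @ concat zl) \<le> p" "p \<le> length (l @ concat zl) + length z"
            using z p by simp_all
          ultimately show ?good using 1 by blast
        next
          case 2
          then have "\<exists>y\<in>set zr. h \<in> set y" by auto
          then obtain ya y yb where y: "zr = ya @ y # yb" "h \<in> set y" "\<forall>x\<in>set ya. h \<notin> set x"
            using split_list_first_prop[of zr "\<lambda>y. h \<in> set y"] by blast
          \<comment> \<open>From \<open>p\<close> the way leads over the rest of \<open>z\<close>
            and the marker-free children \<open>ya\<close> to \<open>q\<close>, the near end of the
            first marked child \<open>y\<close>, and then across \<open>y\<close> to its far end,
            where the count has changed. The remaining case is the mirror image.\<close>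
          define q where "q = length (l @ concat zl @ z @ concat ya)"
          have W': "W = (l @ concat zl @ z @ concat ya) @ y @ (concat yb @ r)" using W z(1) y(1) by simp
          then have takes: "take q W = l @ concat zl @ z @ concat ya" "take (q + length y) W = take q W @ y"
            by (simp_all add: q_def)
          have pq: "p \<le> q" using z p by (simp add: q_def)
          have "q - p \<le> length (concat (z # ya))" using z p by (simp add: q_def)
          also have "\<dots> \<le> B * K" using 2 y(3) z(1) y(1) by (intro piece) auto
          finally have d1: "dist (mval (take p W)) (mval (take q W)) \<le> B * K"
            using dist_mval_take[OF W_in pq] by simp
          have "take q W \<in> lists alphabet" "y \<in> lists alphabet" using W_in W' takes by auto
          then have "dist (mval (take q W)) (mval (take (q + length y) W)) = len (mval y)"
            unfolding takes(2) by (rule dist_mval_append)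
          also have "\<dots> \<le> K" using bound[of "zl @ z # ya" y yb] z(1) y(1) by simp
          finally have "dist (mval (take p W)) (mval (take (q + length y) W)) \<le> D"
            using d1 dist_triangle[OF take_in[of p] take_in[of q] take_in[of "q + length y"]]
            unfolding D_def by simp
          moreover have "count_list y h \<noteq> 0" using y(2) by (simp add: count_list_0_iff)
          then have "count_list (take p W) h < count_list (take (q + length y) W) h"
            unfolding takes(2) using count_mono[OF pq] by simp
          moreover have "q + length y \<le> length W" unfolding W' q_def by simp
          ultimately show ?good by (intro exI[of _ "q + length y"]) simp
        next
          case 3
          then have "\<exists>y\<in>set zl. h \<in> set y" by auto
          then obtain ya y yb where y: "zl = ya @ y # yb" "h \<in> set y" "\<forall>x\<in>set yb. h \<notin> set x"
            using split_list_last_prop[of zl "\<lambda>y. h \<in> set y"] by blast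
          define q where "q = length (l @ concat ya)"
          have W': "W = (l @ concat ya) @ y @ (concat yb @ z @ concat zr @ r)" using W z(1) y(1) by simp
          then have takes: "take q W = l @ concat ya" "take (q + length y) W = take q W @ y"
            by (simp_all add: q_def)
          have qp: "q + length y \<le> p" using z p y(1) by (simp add: q_def)
          have "p - (q + length y) \<le> length (concat (yb @ [z]))" using z p y(1) by (simp add: q_def)
          also have "\<dots> \<le> B * K" using 3 y(3) z(1) y(1) by (intro piece) auto
          finally have d1: "dist (mval (take p W)) (mval (take (q + length y) W)) \<le> B * K"
            using dist_mval_take[OF W_in qp] dist_sym[OF take_in take_in] by simp
          have "take q W \<in> lists alphabet" "y \<in> lists alphabet" using W_in W' takes by auto
          then have "dist (mval (take q W)) (mval (take (q + length y) W)) = len (mval y)"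
            unfolding takes(2) by (rule dist_mval_append)
          also have "\<dots> \<le> K" using bound[of ya y "yb @ z # zr"] z(1) y(1) by simp
          finally have "dist (mval (take p W)) (mval (take q W)) \<le> D"
            using d1 dist_triangle[OF take_in[of p] take_in[of "q + length y"] take_in[of q]]
              dist_sym[OF take_in[of q] take_in[of "q + length y"]]
            unfolding D_def by simp
          moreover have "count_list y h \<noteq> 0" using y(2) by (simp add: count_list_0_iff)
          then have "count_list (take q W) h < count_list (take p W) h"
            using count_mono[OF qp] unfolding takes(2) by simp
          moreover have "q \<le> length W" unfolding W' q_def by simp
          ultimately show ?good by (intro exI[of _ q]) simp
        qed
      qed
    qed
    moreover have "yields P (Inl X0) W"
      using W_tri unfolding triangles_eq derives_iff_yields by blast
    moreover have "in_context [] (Inl X0) []" by (simp add: in_context_def)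
    moreover have "h \<in> set W" by (simp add: W_def)
    ultimately show ?good using p by fastforce
  qed
  then show ?thesis by blast
qed

section \<open>The family of paths labelled by shortest words\<close>

definition normal_form :: "'a \<Rightarrow> 's list" where
  "normal_form g = (SOME u. shortest u \<and> val u = g)"

lemma normal_form: "g \<in> carrier G \<Longrightarrow> shortest (normal_form g)" "g \<in> carrier G \<Longrightarrow> val (normal_form g) = g"
  using someI_ex[OF shortest_exists] unfolding normal_form_def by blast+

text \<open>Reading the path off a word for \<open>inv x \<otimes> y\<close> makes the family
  invariant under left translation. It is directed: the path from \<open>y\<close> to
  \<open>x\<close> need not be the reverse.\<close>

definition combing_path :: "'a \<Rightarrow> 'a \<Rightarrow> 'a set" where
  "combing_path x y = (\<lambda>i. x \<otimes> val (take i (normal_form (inv x \<otimes> y)))) ` {..length (normal_form (inv x \<otimes> y))}"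

text \<open>Translation by \<open>x\<close> turns prefix values of the triangle word into points of
  the three paths. Prefixes ending in the first side have marker count 0, so a position with another
  count belongs to the second or third side.\<close>

lemma combing_path_thin:
  "\<exists>D. \<forall>x\<in>carrier G. \<forall>y\<in>carrier G. \<forall>z\<in>carrier G. \<forall>p\<in>combing_path x y.
     \<exists>q\<in>combing_path y z \<union> combing_path z x. dist p q \<le> D"
proof -
  obtain D where D: "\<And>u v w p. shortest u \<Longrightarrow> shortest v \<Longrightarrow> shortest w \<Longrightarrow>
    val u \<otimes> val v \<otimes> val w = \<one> \<Longrightarrow> p \<le> length (u @ [h] @ v @ [h] @ w) \<Longrightarrow>
    \<exists>p' \<le> length (u @ [h] @ v @ [h] @ w).
       count_list (take p' (u @ [h] @ v @ [h] @ w)) h \<noteq> count_list (take p (u @ [h] @ v @ [h] @ w)) h \<and>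
       dist (mval (take p (u @ [h] @ v @ [h] @ w))) (mval (take p' (u @ [h] @ v @ [h] @ w))) \<le> D"
    using triangle_thin by blast
  have "\<exists>q\<in>combing_path y z \<union> combing_path z x. dist p q \<le> D"
    if xyz: "x \<in> carrier G" "y \<in> carrier G" "z \<in> carrier G" and p: "p \<in> combing_path x y" for x y z p
  proof -
    define u v w where "u = normal_form (inv x \<otimes> y)" and "v = normal_form (inv y \<otimes> z)"
      and "w = normal_form (inv z \<otimes> x)"
    have short: "shortest u" "shortest v" "shortest w"
      and vals: "val u = inv x \<otimes> y" "val v = inv y \<otimes> z" "val w = inv z \<otimes> x"
      unfolding u_def v_def w_def using normal_form xyz by simp_all
    have in_S: "u \<in> lists S" "v \<in> lists S" "w \<in> lists S" using short shortest_in by blast+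
    have closed: "val u \<otimes> val v \<otimes> val w = \<one>"
      unfolding vals using xyz by (simp add: m_assoc inv_mult_cancel)
    obtain i where i: "i \<le> length u" "p = x \<otimes> val (take i u)"
      using p unfolding combing_path_def u_def by auto
    define W where "W = u @ [h] @ v @ [h] @ w"
    have count0: "count_list (take j W) h = 0" "take j W = take j u" if "j \<le> length u" for j
    proof -
      show "take j W = take j u" using that by (simp add: W_def)
      then show "count_list (take j W) h = 0"
        using in_S(1) h_notin by (auto simp: count_list_0_iff dest: in_set_takeD)
    qed
    have "i \<le> length W" using i by (simp add: W_def)
    then obtain p' where p': "p' \<le> length W" "count_list (take p' W) h \<noteq> count_list (take i W) h"
      "dist (mval (take i W)) (mval (take p' W)) \<le> D"
      using D[OF short closed, of i] unfolding W_def by blast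
    then have "\<not> p' \<le> length u" using count0 i by auto
    \<comment> \<open>The summand 1 skips the first marker, so \<open>k\<close> is a position in
      \<open>v\<close>; below, \<open>m\<close> is likewise a position in \<open>w\<close> after the
      second marker.\<close>
    then obtain k where k: "p' = length u + 1 + k" by (metis less_eq_Suc_le not_le le_Suc_ex Suc_eq_plus1)
    have W_take: "mval (take p' W) \<in> carrier G"
      using in_S by (intro mval_in) (auto simp: W_def dest!: in_set_takeD)
    have "dist p (x \<otimes> mval (take p' W)) = dist (mval (take i W)) (mval (take p' W))"
      unfolding i(2) count0(2)[OF i(1)] using in_S xyz W_take by (simp add: dist_translate)
    then have close: "dist p (x \<otimes> mval (take p' W)) \<le> D" using p' by simp
    show ?thesis
    proof (cases "k \<le> length v")
      case True
      then have "take p' W = u @ [h] @ take k v" using k by (simp add: W_def)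
      then have "x \<otimes> mval (take p' W) = y \<otimes> val (take k v)"
        using in_S xyz vals by (simp add: m_assoc inv_mult_cancel)
      then have "x \<otimes> mval (take p' W) \<in> combing_path y z"
        unfolding combing_path_def v_def[symmetric] using True by auto
      with close show ?thesis by blast
    next
      case False
      then obtain m where m: "k = length v + 1 + m" by (metis less_eq_Suc_le not_le le_Suc_ex Suc_eq_plus1)
      then have "take p' W = u @ [h] @ v @ [h] @ take m w" using k by (simp add: W_def)
      then have "x \<otimes> mval (take p' W) = z \<otimes> val (take m w)"
        using in_S xyz vals by (simp add: m_assoc inv_mult_cancel)
      moreover have "m \<le> length w" using p'(1) k m by (simp add: W_def)
      ultimately have "x \<otimes> mval (take p' W) \<in> combing_path z x"
        unfolding combing_path_def w_def[symmetric] by auto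
      with close show ?thesis by blast
    qed
  qed
  then show ?thesis by blast
qed

text \<open>Finitely many elements have length at most 1 and each has one normal form; the sum of
  the lengths of these words bounds them all.\<close>

lemma combing_path_short:
  "\<exists>D. \<forall>x\<in>carrier G. \<forall>y\<in>carrier G. dist x y \<le> 1 \<longrightarrow> (\<forall>p\<in>combing_path x y. dist p x \<le> D)"
proof -
  define D where "D = (\<Sum>g\<in>{g \<in> carrier G. len g \<le> 1}. length (normal_form g))"
  have "dist p x \<le> D" if xy: "x \<in> carrier G" "y \<in> carrier G" "dist x y \<le> 1" and p: "p \<in> combing_path x y" for x y p
  proof -
    define u where "u = normal_form (inv x \<otimes> y)"
    have "u \<in> lists S" using normal_form(1) shortest_in xy unfolding u_def by simp
    obtain i where i: "p = x \<otimes> val (take i u)" "i \<le> length u" using p unfolding combing_path_def u_def by auto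
    have "dist p x = dist x p" using i \<open>u \<in> lists S\<close> xy by (intro dist_sym) simp_all
    also have "\<dots> = len (val (take i u))"
      using i \<open>u \<in> lists S\<close> xy by (simp add: dist_eq inv_mult_cancel)
    also have "\<dots> \<le> length u" using len_le[of "take i u"] \<open>u \<in> lists S\<close> i by simp
    also have "\<dots> \<le> D"
      unfolding D_def u_def using xy finite_ball
      by (intro member_le_sum[of _ _ "\<lambda>g. length (normal_form g)"]) (simp_all add: dist_eq)
    finally show ?thesis .
  qed
  then show ?thesis by blast
qed

theorem hyperbolic: "word_hyperbolic G S ev"
proof -
  obtain D1 where D1: "\<And>x y z p. x \<in> carrier G \<Longrightarrow> y \<in> carrier G \<Longrightarrow> z \<in> carrier G \<Longrightarrow> p \<in> combing_path x y \<Longrightarrow>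
     \<exists>q\<in>combing_path y z \<union> combing_path z x. dist p q \<le> D1"
    using combing_path_thin by blast
  obtain D2 where D2: "\<And>x y p. x \<in> carrier G \<Longrightarrow> y \<in> carrier G \<Longrightarrow> dist x y \<le> 1 \<Longrightarrow> p \<in> combing_path x y \<Longrightarrow>
      dist p x \<le> D2"
    using combing_path_short by blast
  have "thin_path_family (carrier G) dist combing_path (D1 + D2 + 1)"
  proof (intro thin_path_family.intro graph_metric thin_path_family_axioms.intro)
    show "0 < D1 + D2 + 1" by simp
    fix x y assume xy: "x \<in> carrier G" "y \<in> carrier G"
    define u where "u = normal_form (inv x \<otimes> y)"
    define c where "c i = x \<otimes> val (take i u)" for i
    have u: "u \<in> lists S" "val u = inv x \<otimes> y" using normal_form shortest_in xy unfolding u_def by simp_all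
    have "c i \<in> carrier G" for i using xy u by (simp add: c_def)
    moreover have c: "combing_path x y = c ` {..length u}" by (simp add: c_def[abs_def] combing_path_def u_def)
    ultimately have "combing_path x y \<subseteq> carrier G" by auto
    moreover note c
    moreover have "c 0 = x" "c (length u) = y" using xy u by (simp_all add: c_def inv_mult_cancel)
    moreover have "dist (c i) (c (Suc i)) \<le> 1" for i
      using dist_word[OF u(1), of i "Suc i"] u xy by (simp add: c_def dist_translate)
    ultimately show "\<exists>c n. c 0 = x \<and> c n = y \<and> (\<forall>i<n. dist (c i) (c (Suc i)) \<le> 1) \<and>
        combing_path x y = c ` {..n} \<and> combing_path x y \<subseteq> carrier G" by blast
  next
    fix x y z p assume "x \<in> carrier G" "y \<in> carrier G" "z \<in> carrier G" "p \<in> combing_path x y"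
    from D1[OF this] show "\<exists>q\<in>combing_path y z \<union> combing_path z x. dist p q \<le> D1 + D2 + 1"
      by (meson trans_le_add1 le_trans)
  next
    fix x y p assume "x \<in> carrier G" "y \<in> carrier G" "dist x y \<le> 1" "p \<in> combing_path x y"
    from D2[OF this] show "dist p x \<le> D1 + D2 + 1" by simp
  qed
  then show ?thesis unfolding word_hyperbolic_iff by (rule thin_path_family.four_point)
qed

end

theorem theorem1p1:
  fixes G :: "('g, 'b) monoid_scheme" and S :: "'a set" and iv :: "'a \<Rightarrow> 'a"
    and ev :: "'a \<Rightarrow> 'g" and hsh :: 'a
  assumes "gen_choice G S iv ev"
    and "hsh \<notin> S"
  shows "word_hyperbolic G S ev \<longleftrightarrow>
    (\<exists>R. R \<subseteq> lists S \<and> word_ev G ev ` R = carrier G \<and> regular_lang S R \<and>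
       context_free (insert hsh S)
         {u @ [hsh] @ v @ [hsh] @ w | u v w. u \<in> R \<and> v \<in> R \<and> w \<in> R \<and>
            word_ev G ev u \<otimes>\<^bsub>G\<^esub> word_ev G ev v \<otimes>\<^bsub>G\<^esub> word_ev G ev w = \<one>\<^bsub>G\<^esub>})"
proof -
  interpret marked_group G S iv ev hsh
    using assms by (auto simp: marked_group_def generated_group_def generated_group_axioms_def
      marked_group_axioms_def gen_choice_def)
  show ?thesis
    unfolding triangles_def[symmetric]
  proof
    assume "word_hyperbolic G S ev"
    then obtain K :: nat where "\<forall>x\<in>carrier G. \<forall>y\<in>carrier G. \<forall>z\<in>carrier G. \<forall>p\<in>carrier G.
       min (int (dist p x) + int (dist p y) - int (dist x y)) (int (dist p y) + int (dist p z) - int (dist y z))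
         \<le> int (dist p x) + int (dist p z) - int (dist x z) + int K"
      unfolding word_hyperbolic_iff by blast
    then interpret hyperbolic_group G S iv ev hsh K by unfold_locales blast
    show "\<exists>R. R \<subseteq> lists S \<and> val ` R = carrier G \<and> regular_lang S R \<and> context_free alphabet (triangles R)"
      by (rule geodesics_regular_combing_context_free)
  next
    assume "\<exists>R. R \<subseteq> lists S \<and> val ` R = carrier G \<and> regular_lang S R \<and> context_free alphabet (triangles R)"
    then obtain R P X0 where "R \<subseteq> lists S" "val ` R = carrier G" "finite P"
      "\<forall>(X, \<alpha>)\<in>P. \<forall>a. Inr a \<in> set \<alpha> \<longrightarrow> a \<in> alphabet"
      "triangles R = {w \<in> lists alphabet. (cfg_step P)\<^sup>*\<^sup>* [Inl X0] (map Inr w)}"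
      unfolding context_free_def by blast
    then interpret combing_grammar G S iv ev hsh R P X0 by unfold_locales blast+
    show "word_hyperbolic G S ev" by (rule hyperbolic)
  qed
qed

end
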